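(* Let $f:\mathbb{R}\to\mathbb{R}$ be a normalized stationary centered Gaussian process of class $\mathcal{C}^2$ and let $\kappa$ denote its correlation function. Assume that $\kappa$ and $\kappa''$ are square-integrable on $\mathbb{R}$ and that $\|\kappa\|_{2,\eta}\to0$ as $\eta\to+\infty$. Then the constant $\sigma^2$ defined by $$\sigma^2=\frac1\pi+\frac{2}{\pi^2}\int_0^{+\infty}\left(\frac{1-\kappa(t)^2-\kappa'(t)^2}{(1-\kappa(t)^2)^{3/2}}\left(\sqrt{1-a(t)^2}+a(t)\arcsin(a(t))\right)-1\right)dt,$$ with $a(t)=\dfrac{\kappa(t)\kappa'(t)^2-\kappa(t)^2\kappa''(t)+\kappa''(t)}{1-\kappa(t)^2-\kappa'(t)^2}\in[-1,1]$ for $t>0$, satisfies $$\sigma^2\ge\frac{1}{\pi^2}\int_0^{+\infty}\left(\kappa(z)+\kappa''(z)\right)^2dz>0.$$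
   Context: A process is of class $\mathcal{C}^p$ if its trajectories are almost surely $\mathcal{C}^p$. The correlation function is $\kappa(x)=\mathbb{E}[f(0)f(x)]$; a stationary centered Gaussian process of class at least $\mathcal{C}^1$ is normalized if $\kappa(0)=1=-\kappa''(0)$. $\|\kappa\|_{2,\eta}=\sup\{|\kappa^{(l)}(x)|:0\le l\le2,\ |x|\ge\eta\}$. *)

theory Defs
  imports "HOL-Probability.Probability"
begin

text \<open>A real random process on a probability space \<open>M\<close> is a map \<open>f\<close> with \<open>f x \<omega>\<close> the value
  at the point \<open>x\<close> of the trajectory indexed by \<open>\<omega>\<close>.\<close>

text \<open>The second disjunct makes constants Gaussian (variance zero), as is needed for the linear
  combinations in the definition of a Gaussian process.\<close>

definition gaussian_rv :: "'a measure \<Rightarrow> ('a \<Rightarrow> real) \<Rightarrow> bool" where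
  "gaussian_rv M X \<longleftrightarrow> X \<in> borel_measurable M \<and>
     ((\<exists>\<mu> s. s > 0 \<and> distributed M lborel X (normal_density \<mu> s)) \<or>
      (\<exists>\<mu>. AE \<omega> in M. X \<omega> = \<mu>))"

definition gaussian_process :: "'a measure \<Rightarrow> (real \<Rightarrow> 'a \<Rightarrow> real) \<Rightarrow> bool" where
  "gaussian_process M f \<longleftrightarrow>
     (\<forall>(S :: real set) c. finite S \<longrightarrow> gaussian_rv M (\<lambda>\<omega>. \<Sum>x\<in>S. c x * f x \<omega>))"

definition centered_process :: "'a measure \<Rightarrow> (real \<Rightarrow> 'a \<Rightarrow> real) \<Rightarrow> bool" where
  "centered_process M f \<longleftrightarrow> (\<forall>x. integrable M (f x) \<and> integral\<^sup>L M (f x) = 0)"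

text \<open>Invariance under translations of the law of the whole process, a measure on the product
  sigma-algebra of \<open>real \<Rightarrow> real\<close>.\<close>

definition stationary_process :: "'a measure \<Rightarrow> (real \<Rightarrow> 'a \<Rightarrow> real) \<Rightarrow> bool" where
  "stationary_process M f \<longleftrightarrow>
     (\<forall>h. distr M (\<Pi>\<^sub>M x\<in>UNIV. borel) (\<lambda>\<omega> x. f (x + h) \<omega>) =
          distr M (\<Pi>\<^sub>M x\<in>UNIV. borel) (\<lambda>\<omega> x. f x \<omega>))"

definition class_C :: "nat \<Rightarrow> (real \<Rightarrow> real) \<Rightarrow> bool" where
  "class_C p g \<longleftrightarrow>
     (\<forall>k<p. \<forall>x. (deriv ^^ k) g differentiable (at x)) \<and> continuous_on UNIV ((deriv ^^ p) g)"

definition process_class_C :: "nat \<Rightarrow> 'a measure \<Rightarrow> (real \<Rightarrow> 'a \<Rightarrow> real) \<Rightarrow> bool" where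
  "process_class_C p M f \<longleftrightarrow> (AE \<omega> in M. class_C p (\<lambda>x. f x \<omega>))"

definition correlation :: "'a measure \<Rightarrow> (real \<Rightarrow> 'a \<Rightarrow> real) \<Rightarrow> real \<Rightarrow> real" where
  "correlation M f x = integral\<^sup>L M (\<lambda>\<omega>. f 0 \<omega> * f x \<omega>)"

definition normalized_process :: "'a measure \<Rightarrow> (real \<Rightarrow> 'a \<Rightarrow> real) \<Rightarrow> bool" where
  "normalized_process M f \<longleftrightarrow>
     correlation M f 0 = 1 \<and> - (deriv ^^ 2) (correlation M f) 0 = 1"

text \<open>The supremum is taken in the extended reals, so that it is meaningful for unbounded
  functions as well.\<close>

definition tail_norm :: "nat \<Rightarrow> real \<Rightarrow> (real \<Rightarrow> real) \<Rightarrow> ereal" where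
  "tail_norm p \<eta> \<kappa> = Sup {ereal \<bar>(deriv ^^ l) \<kappa> x\<bar> | l x. l \<le> p \<and> \<eta> \<le> \<bar>x\<bar>}"

definition a_fun :: "(real \<Rightarrow> real) \<Rightarrow> real \<Rightarrow> real" where
  "a_fun \<kappa> t =
     (\<kappa> t * (deriv \<kappa> t)\<^sup>2 - (\<kappa> t)\<^sup>2 * (deriv ^^ 2) \<kappa> t + (deriv ^^ 2) \<kappa> t) /
     (1 - (\<kappa> t)\<^sup>2 - (deriv \<kappa> t)\<^sup>2)"

definition sigma_integrand :: "(real \<Rightarrow> real) \<Rightarrow> real \<Rightarrow> real" where
  "sigma_integrand \<kappa> t =
     (1 - (\<kappa> t)\<^sup>2 - (deriv \<kappa> t)\<^sup>2) / (1 - (\<kappa> t)\<^sup>2) powr (3 / 2) *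
     (sqrt (1 - (a_fun \<kappa> t)\<^sup>2) + a_fun \<kappa> t * arcsin (a_fun \<kappa> t)) - 1"

definition sigma_squared :: "(real \<Rightarrow> real) \<Rightarrow> real" where
  "sigma_squared \<kappa> = 1 / pi + 2 / pi\<^sup>2 * (LBINT t:{0<..}. sigma_integrand \<kappa> t)"

end

(* Write k for the correlation function, A = arcsin k / sqrt (1 - k^2) and P = k' A. The function
   m(a) = sqrt (1 - a^2) + a arcsin a has second derivative at least 1. Bounding m(a) from below by
   its tangent at b = -k plus (a - b)^2 / 2, and using a + k = (1 - k^2) (k + k'') / D with
   D = 1 - k^2 - k'^2, all remaining terms combine into an exact derivative:
     sigma_integrand >= - P' + (k + k'')^2 / 2.
   Since P >= - pi / 2 and P tends to 0 at infinity, integration gives the lower bound. If its right-hand side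
   were 0, then k + k'' = 0 on the half-line and D would vanish identically there.

   The regularity of k comes from mean square calculus: in a linear space of centered Gaussian
   variables E cos X = exp (- E X^2 / 2), so almost sure convergence forces convergence in mean
   square, and path derivatives are mean square derivatives. Near 0 the integrand is bounded because
   E (f'(h) - f'(0))^2 = 2 (1 + k''(h)) is of order h^2, as f has a second derivative. *)

theory Submission
  imports Defs
begin

section \<open>Square integrable functions and Gaussian linear spaces\<close>

text \<open>By the Kac-Rice formula, the integrand divided by pi^2 is the two-point intensity of the
  zeros of f minus the square 1/pi^2 of their intensity. Indeed D / (1 - k^2) is the variance of
  f'(0) conditioned on f(0) and f(t), a is minus the conditional correlation of f'(0) and f'(t), and
  (2/pi) m(a) is E |X Y| for standard Gaussian X, Y with that correlation. The tangent point -k is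
  the value that a takes when k + k'' = 0, so the quadratic remainder of the tangent estimate
  measures k + k''. The lower bound -pi/2 for P is its limit at 0; multiplied by 2/pi^2 it cancels
  the leading 1/pi. The obstacle at the origin is a quotient of vanishing terms: (1 - k^2)^(3/2) has
  order 3, so D must be shown to be O(t^4), although paths of class C^2 do not provide a classical
  fourth derivative of k. At infinity the integrand is quadratic in k, k' and k'', and the square
  integrability of k' has to be derived.\<close>

definition sq_integrable :: "'a measure \<Rightarrow> ('a \<Rightarrow> real) \<Rightarrow> bool" where
  "sq_integrable M X \<longleftrightarrow> X \<in> borel_measurable M \<and> integrable M (\<lambda>\<omega>. (X \<omega>)\<^sup>2)"

lemma sq_integrable_mult:
  assumes "sq_integrable M X" "sq_integrable M Y"
  shows "integrable M (\<lambda>\<omega>. X \<omega> * Y \<omega>)"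
proof (rule Bochner_Integration.integrable_bound)
  show "integrable M (\<lambda>\<omega>. (X \<omega>)\<^sup>2 + (Y \<omega>)\<^sup>2)"
    using assms by (auto simp: sq_integrable_def)
  show "(\<lambda>\<omega>. X \<omega> * Y \<omega>) \<in> borel_measurable M"
    using assms by (auto simp: sq_integrable_def)
  have "\<bar>x * y\<bar> \<le> x\<^sup>2 + y\<^sup>2" for x y :: real
  proof -
    have "2 * \<bar>x * y\<bar> \<le> x\<^sup>2 + y\<^sup>2"
      using sum_squares_bound[of "\<bar>x\<bar>" "\<bar>y\<bar>"] by (simp add: abs_mult)
    then show ?thesis using abs_ge_zero[of "x * y"] by linarith
  qed
  then show "AE \<omega> in M. norm (X \<omega> * Y \<omega>) \<le> norm ((X \<omega>)\<^sup>2 + (Y \<omega>)\<^sup>2)"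
    by simp
qed

lemma sq_integrable_lincomb:
  assumes "sq_integrable M X" "sq_integrable M Y"
  shows "sq_integrable M (\<lambda>\<omega>. a * X \<omega> + b * Y \<omega>)"
proof -
  have "integrable M (\<lambda>\<omega>. a\<^sup>2 * (X \<omega>)\<^sup>2 + 2 * a * b * (X \<omega> * Y \<omega>) + b\<^sup>2 * (Y \<omega>)\<^sup>2)"
    using assms sq_integrable_mult[OF assms] by (auto simp: sq_integrable_def)
  also have "(\<lambda>\<omega>. a\<^sup>2 * (X \<omega>)\<^sup>2 + 2 * a * b * (X \<omega> * Y \<omega>) + b\<^sup>2 * (Y \<omega>)\<^sup>2)
      = (\<lambda>\<omega>. (a * X \<omega> + b * Y \<omega>)\<^sup>2)"
    by (auto simp: fun_eq_iff power2_sum power_mult_distrib)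
  finally show ?thesis using assms by (auto simp: sq_integrable_def)
qed

lemma sq_integrable_diff:
  assumes "sq_integrable M X" "sq_integrable M Y"
  shows "sq_integrable M (\<lambda>\<omega>. X \<omega> - Y \<omega>)"
  using sq_integrable_lincomb[OF assms, of 1 "-1"] by simp

lemma integral_lincomb_mult:
  assumes "sq_integrable M X" "sq_integrable M Y" "sq_integrable M Z"
  shows "(\<integral>\<omega>. (a * X \<omega> + b * Y \<omega>) * Z \<omega> \<partial>M)
    = a * (\<integral>\<omega>. X \<omega> * Z \<omega> \<partial>M) + b * (\<integral>\<omega>. Y \<omega> * Z \<omega> \<partial>M)"
proof -
  have "(\<lambda>\<omega>. (a * X \<omega> + b * Y \<omega>) * Z \<omega>) = (\<lambda>\<omega>. a * (X \<omega> * Z \<omega>) + b * (Y \<omega> * Z \<omega>))"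
    by (auto simp: algebra_simps)
  then show ?thesis
    using sq_integrable_mult[OF assms(1,3)] sq_integrable_mult[OF assms(2,3)] by simp
qed

lemma integral_mult_lincomb:
  assumes "sq_integrable M X" "sq_integrable M Y" "sq_integrable M Z"
  shows "(\<integral>\<omega>. Z \<omega> * (a * X \<omega> + b * Y \<omega>) \<partial>M)
    = a * (\<integral>\<omega>. Z \<omega> * X \<omega> \<partial>M) + b * (\<integral>\<omega>. Z \<omega> * Y \<omega> \<partial>M)"
  using integral_lincomb_mult[OF assms, of a b] by (simp add: mult.commute)

lemma integral_lincomb_square:
  assumes "sq_integrable M X" "sq_integrable M Y"
  shows "(\<integral>\<omega>. (a * X \<omega> + b * Y \<omega>)\<^sup>2 \<partial>M)
    = a\<^sup>2 * (\<integral>\<omega>. (X \<omega>)\<^sup>2 \<partial>M) + 2 * a * b * (\<integral>\<omega>. X \<omega> * Y \<omega> \<partial>M) + b\<^sup>2 * (\<integral>\<omega>. (Y \<omega>)\<^sup>2 \<partial>M)"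
proof -
  have "(\<lambda>\<omega>. (a * X \<omega> + b * Y \<omega>)\<^sup>2)
    = (\<lambda>\<omega>. a\<^sup>2 * (X \<omega>)\<^sup>2 + 2 * a * b * (X \<omega> * Y \<omega>) + b\<^sup>2 * (Y \<omega>)\<^sup>2)"
    by (auto simp: fun_eq_iff power2_sum power_mult_distrib)
  then show ?thesis
    using assms sq_integrable_mult[OF assms] by (simp add: sq_integrable_def)
qed

lemma integral_Cauchy_Schwarz:
  assumes "sq_integrable M X" "sq_integrable M Y"
  shows "(\<integral>\<omega>. X \<omega> * Y \<omega> \<partial>M)\<^sup>2 \<le> (\<integral>\<omega>. (X \<omega>)\<^sup>2 \<partial>M) * (\<integral>\<omega>. (Y \<omega>)\<^sup>2 \<partial>M)"
proof -
  define a b c where "a = (\<integral>\<omega>. (X \<omega>)\<^sup>2 \<partial>M)" and "b = (\<integral>\<omega>. (Y \<omega>)\<^sup>2 \<partial>M)"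
    and "c = (\<integral>\<omega>. X \<omega> * Y \<omega> \<partial>M)"
  have q: "0 \<le> s\<^sup>2 * a + 2 * s * t * c + t\<^sup>2 * b" for s t
    unfolding a_def b_def c_def integral_lincomb_square[OF assms, symmetric] by simp
  have "0 \<le> b" unfolding b_def by simp
  have "c\<^sup>2 \<le> a * b"
  proof (cases "b = 0")
    case True
    have "c = 0"
    proof (rule ccontr)
      assume "c \<noteq> 0"
      \<comment> \<open>With \<open>b = 0\<close> the form is affine in its second argument; this
        choice gives it the value a - (a + 1) = -1.\<close>
      with q[of 1 "- (a + 1) / (2 * c)"] True show False by (simp add: field_simps)
    qed
    then show ?thesis using True by simp
  next
    case False
    with \<open>0 \<le> b\<close> have "0 < b" by simp
    have "0 \<le> b * (a * b - c\<^sup>2)"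
      using q[of b "-c"] by (simp add: power2_eq_square algebra_simps)
    with \<open>0 < b\<close> show ?thesis by (simp add: zero_le_mult_iff)
  qed
  then show ?thesis by (simp add: a_def b_def c_def)
qed

lemma integral_mult_tendsto:
  fixes X :: "nat \<Rightarrow> 'a \<Rightarrow> real"
  assumes "\<And>n. sq_integrable M (X n)" "sq_integrable M Y" "sq_integrable M Z"
    and "(\<lambda>n. \<integral>\<omega>. (X n \<omega> - Y \<omega>)\<^sup>2 \<partial>M) \<longlonglongrightarrow> 0"
  shows "(\<lambda>n. \<integral>\<omega>. X n \<omega> * Z \<omega> \<partial>M) \<longlonglongrightarrow> (\<integral>\<omega>. Y \<omega> * Z \<omega> \<partial>M)"
proof -
  have eq: "(\<integral>\<omega>. (X n \<omega> - Y \<omega>) * Z \<omega> \<partial>M) = (\<integral>\<omega>. X n \<omega> * Z \<omega> \<partial>M) - (\<integral>\<omega>. Y \<omega> * Z \<omega> \<partial>M)" for n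
    using integral_lincomb_mult[OF assms(1,2,3), of 1 n "-1"] by simp
  have lim: "(\<lambda>n. (\<integral>\<omega>. (X n \<omega> - Y \<omega>) * Z \<omega> \<partial>M)\<^sup>2) \<longlonglongrightarrow> 0"
  proof (rule tendsto_sandwich[OF _ _ tendsto_const])
    show "\<forall>\<^sub>F n in sequentially. (\<integral>\<omega>. (X n \<omega> - Y \<omega>) * Z \<omega> \<partial>M)\<^sup>2
        \<le> (\<integral>\<omega>. (X n \<omega> - Y \<omega>)\<^sup>2 \<partial>M) * (\<integral>\<omega>. (Z \<omega>)\<^sup>2 \<partial>M)"
      by (intro always_eventually allI integral_Cauchy_Schwarz sq_integrable_diff assms)
    show "(\<lambda>n. (\<integral>\<omega>. (X n \<omega> - Y \<omega>)\<^sup>2 \<partial>M) * (\<integral>\<omega>. (Z \<omega>)\<^sup>2 \<partial>M)) \<longlonglongrightarrow> 0"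
      using tendsto_mult_left_zero[OF assms(4)] by simp
  qed auto
  have "(\<lambda>n. (\<integral>\<omega>. X n \<omega> * Z \<omega> \<partial>M) - (\<integral>\<omega>. Y \<omega> * Z \<omega> \<partial>M)) \<longlonglongrightarrow> 0"
    using tendsto_real_sqrt[OF lim] unfolding eq by (simp add: tendsto_rabs_zero_iff)
  then show ?thesis by (simp add: LIM_zero_iff)
qed

lemma integral_square_tendsto:
  fixes X :: "nat \<Rightarrow> 'a \<Rightarrow> real"
  assumes "\<And>n. sq_integrable M (X n)" "sq_integrable M Y"
    and lim: "(\<lambda>n. \<integral>\<omega>. (X n \<omega> - Y \<omega>)\<^sup>2 \<partial>M) \<longlonglongrightarrow> 0"
  shows "(\<lambda>n. \<integral>\<omega>. (X n \<omega>)\<^sup>2 \<partial>M) \<longlonglongrightarrow> (\<integral>\<omega>. (Y \<omega>)\<^sup>2 \<partial>M)"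
proof -
  have "(\<lambda>n. (\<integral>\<omega>. (X n \<omega> - Y \<omega>)\<^sup>2 \<partial>M) + 2 * (\<integral>\<omega>. X n \<omega> * Y \<omega> \<partial>M) - (\<integral>\<omega>. (Y \<omega>)\<^sup>2 \<partial>M))
     \<longlonglongrightarrow> 0 + 2 * (\<integral>\<omega>. Y \<omega> * Y \<omega> \<partial>M) - (\<integral>\<omega>. (Y \<omega>)\<^sup>2 \<partial>M)"
    by (intro tendsto_intros lim integral_mult_tendsto[OF assms(1,2,2,3)])
  moreover have "(\<integral>\<omega>. (X n \<omega> - Y \<omega>)\<^sup>2 \<partial>M) + 2 * (\<integral>\<omega>. X n \<omega> * Y \<omega> \<partial>M) - (\<integral>\<omega>. (Y \<omega>)\<^sup>2 \<partial>M)
      = (\<integral>\<omega>. (X n \<omega>)\<^sup>2 \<partial>M)" for n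
    using integral_lincomb_square[OF assms(1,2), of 1 n "-1"] by simp
  ultimately show ?thesis by (simp add: power2_eq_square)
qed

text \<open>The cosine identity is the real part of the characteristic function. Closure under
  scaling extends it to all arguments, and, unlike a condition on densities, it includes the zero
  variable and survives almost sure limits.\<close>

definition gauss_space :: "'a measure \<Rightarrow> ('a \<Rightarrow> real) set \<Rightarrow> bool" where
  "gauss_space M V \<longleftrightarrow>
     (\<forall>X\<in>V. sq_integrable M X \<and>
        (\<integral>\<omega>. cos (X \<omega>) \<partial>M) = exp (- (\<integral>\<omega>. (X \<omega>)\<^sup>2 \<partial>M) / 2)) \<and>
     (\<forall>X\<in>V. \<forall>Y\<in>V. \<forall>a b. (\<lambda>\<omega>. a * X \<omega> + b * Y \<omega>) \<in> V)"

text \<open>Measurability of the limit is demanded separately: over an incomplete measure, an almost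
  everywhere limit of measurable functions can fail to be measurable.\<close>

definition ae_closure :: "'a measure \<Rightarrow> ('a \<Rightarrow> real) set \<Rightarrow> ('a \<Rightarrow> real) set" where
  "ae_closure M V = {Y \<in> borel_measurable M.
     \<exists>X. (\<forall>n::nat. X n \<in> V) \<and> (AE \<omega> in M. (\<lambda>n. X n \<omega>) \<longlonglongrightarrow> Y \<omega>)}"

lemma gauss_spaceD:
  assumes "gauss_space M V" "X \<in> V"
  shows "sq_integrable M X" and "(\<integral>\<omega>. cos (X \<omega>) \<partial>M) = exp (- (\<integral>\<omega>. (X \<omega>)\<^sup>2 \<partial>M) / 2)"
  using assms unfolding gauss_space_def by blast+

lemma gauss_space_lincomb:
  "gauss_space M V \<Longrightarrow> X \<in> V \<Longrightarrow> Y \<in> V \<Longrightarrow> (\<lambda>\<omega>. a * X \<omega> + b * Y \<omega>) \<in> V"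
  unfolding gauss_space_def by blast

lemma gauss_space_diff:
  "gauss_space M V \<Longrightarrow> X \<in> V \<Longrightarrow> Y \<in> V \<Longrightarrow> (\<lambda>\<omega>. X \<omega> - Y \<omega>) \<in> V"
  using gauss_space_lincomb[of M V X Y 1 "-1"] by simp

text \<open>The cosine is bounded by 1, so dominated convergence applies without any control of
  moments. The logarithm of the cosine identity then returns the second moments.\<close>

lemma (in prob_space) gauss_space_vanish:
  assumes V: "gauss_space M V" and X: "\<And>n::nat. X n \<in> V"
    and lim: "AE \<omega> in M. (\<lambda>n. X n \<omega>) \<longlonglongrightarrow> 0"
  shows "(\<lambda>n. \<integral>\<omega>. (X n \<omega>)\<^sup>2 \<partial>M) \<longlonglongrightarrow> 0"
proof -
  have [measurable]: "X n \<in> borel_measurable M" for n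
    using V X unfolding gauss_space_def sq_integrable_def by blast
  have "(\<lambda>n. \<integral>\<omega>. cos (X n \<omega>) \<partial>M) \<longlonglongrightarrow> (\<integral>\<omega>. 1 \<partial>M)"
  proof (rule integral_dominated_convergence[where w = "\<lambda>_. 1"])
    show "AE \<omega> in M. (\<lambda>n. cos (X n \<omega>)) \<longlonglongrightarrow> 1"
      using lim by eventually_elim (use tendsto_cos in fastforce)
  qed auto
  then have "(\<lambda>n. exp (- (\<integral>\<omega>. (X n \<omega>)\<^sup>2 \<partial>M) / 2)) \<longlonglongrightarrow> 1"
    using V X by (simp add: gauss_space_def prob_space)
  from tendsto_ln[OF this] have "(\<lambda>n. (- (\<integral>\<omega>. (X n \<omega>)\<^sup>2 \<partial>M) / 2)) \<longlonglongrightarrow> 0" by simp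
  from tendsto_mult_left[OF this, of "-2"] show ?thesis by simp
qed

text \<open>By \<open>gauss_space_vanish\<close> an almost everywhere convergent sequence is Cauchy in mean square.\<close>

lemma (in prob_space) gauss_space_limit:
  assumes V: "gauss_space M V" and X: "\<And>n::nat. X n \<in> V"
    and Y[measurable]: "Y \<in> borel_measurable M"
    and lim: "AE \<omega> in M. (\<lambda>n. X n \<omega>) \<longlonglongrightarrow> Y \<omega>"
  shows "sq_integrable M Y" and "(\<lambda>n. \<integral>\<omega>. (X n \<omega> - Y \<omega>)\<^sup>2 \<partial>M) \<longlonglongrightarrow> 0"
proof -
  have sqX: "sq_integrable M (X n)" for n
    using V X by (rule gauss_spaceD)
  then have [measurable]: "X n \<in> borel_measurable M" for n
    unfolding sq_integrable_def by blast
  define v where "v n m = (\<integral>\<omega>. (X n \<omega> - X m \<omega>)\<^sup>2 \<partial>M)" for n m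
  have nn: "(\<integral>\<^sup>+\<omega>. ennreal ((X n \<omega> - X m \<omega>)\<^sup>2) \<partial>M) = ennreal (v n m)" for n m
    unfolding v_def using sq_integrable_diff[OF sqX sqX]
    by (intro nn_integral_eq_integral) (auto simp: sq_integrable_def)
  have cauchy: "\<exists>N. \<forall>n\<ge>N. \<forall>m\<ge>N. v n m < e" if "e > 0" for e
  proof (rule ccontr)
    \<comment> \<open>A failure of the Cauchy property supplies differences of terms of the sequence
      that lie in \<open>V\<close>, tend to 0 almost everywhere and keep second moments at least
      \<open>e\<close>.\<close>
    assume "\<not> ?thesis"
    then have "\<forall>N. \<exists>n\<ge>N. \<exists>m\<ge>N. v n m \<ge> e" by (auto simp: not_less)
    then obtain p q where pq: "\<And>N. p N \<ge> N" "\<And>N. q N \<ge> N" "\<And>N. v (p N) (q N) \<ge> e"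
      by metis
    have p: "filterlim p at_top sequentially" and q: "filterlim q at_top sequentially"
      using pq(1,2) by (auto intro: filterlim_at_top_mono[OF filterlim_ident])
    have "(\<lambda>k. v (p k) (q k)) \<longlonglongrightarrow> 0"
      unfolding v_def
    proof (rule gauss_space_vanish[OF V])
      show "(\<lambda>\<omega>. X (p k) \<omega> - X (q k) \<omega>) \<in> V" for k
        using gauss_space_diff[OF V X X] .
      show "AE \<omega> in M. (\<lambda>k. X (p k) \<omega> - X (q k) \<omega>) \<longlonglongrightarrow> 0"
        using lim
      proof eventually_elim
        case (elim \<omega>)
        from tendsto_diff[OF filterlim_compose[OF elim p] filterlim_compose[OF elim q]]
        show ?case by simp
      qed
    qed
    then have "\<forall>\<^sub>F k in sequentially. v (p k) (q k) < e"
      using that by (rule order_tendstoD)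
    then show False using pq(3) by (auto simp: eventually_sequentially not_less[symmetric])
  qed
  \<comment> \<open>Fatou's lemma, in extended nonnegative integrals because square integrability of
    \<open>Y\<close> is not yet known.\<close>
  have bound: "(\<integral>\<^sup>+\<omega>. ennreal ((X n \<omega> - Y \<omega>)\<^sup>2) \<partial>M) \<le> ennreal e"
    if "\<forall>m\<ge>N. v n m < e" for n N e
  proof -
    have "(\<integral>\<^sup>+\<omega>. ennreal ((X n \<omega> - Y \<omega>)\<^sup>2) \<partial>M)
        = (\<integral>\<^sup>+\<omega>. liminf (\<lambda>m. ennreal ((X n \<omega> - X m \<omega>)\<^sup>2)) \<partial>M)"
    proof (rule nn_integral_cong_AE)
      show "AE \<omega> in M. ennreal ((X n \<omega> - Y \<omega>)\<^sup>2) = liminf (\<lambda>m. ennreal ((X n \<omega> - X m \<omega>)\<^sup>2))"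
        using lim
      proof eventually_elim
        case (elim \<omega>)
        have "(\<lambda>m. ennreal ((X n \<omega> - X m \<omega>)\<^sup>2)) \<longlonglongrightarrow> ennreal ((X n \<omega> - Y \<omega>)\<^sup>2)"
          by (intro tendsto_ennrealI tendsto_intros elim)
        then show ?case by (intro lim_imp_Liminf[symmetric]) auto
      qed
    qed
    also have "\<dots> \<le> liminf (\<lambda>m. ennreal (v n m))"
      unfolding nn[symmetric] by (intro nn_integral_liminf) auto
    also have "\<dots> \<le> ennreal e"
    proof -
      have "liminf (\<lambda>m. ennreal (v n m)) \<le> limsup (\<lambda>m. ennreal (v n m))"
        by (intro Liminf_le_Limsup) auto
      also have "\<dots> \<le> ennreal e"
        by (intro Limsup_bounded) (use that in \<open>auto simp: eventually_sequentially less_imp_le intro!: exI[of _ N] ennreal_leI\<close>)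
      finally show ?thesis .
    qed
    finally show ?thesis .
  qed
  have sqD: "sq_integrable M (\<lambda>\<omega>. X n \<omega> - Y \<omega>)" and iD: "(\<integral>\<omega>. (X n \<omega> - Y \<omega>)\<^sup>2 \<partial>M) \<le> e"
    if "\<forall>m\<ge>N. v n m < e" and "e > 0" for n N e
  proof -
    have "(\<integral>\<^sup>+\<omega>. ennreal ((X n \<omega> - Y \<omega>)\<^sup>2) \<partial>M) < \<infinity>"
      using bound[OF that(1)] by (rule order.strict_trans1) simp
    then have i: "integrable M (\<lambda>\<omega>. (X n \<omega> - Y \<omega>)\<^sup>2)"
      by (intro integrableI_nonneg) auto
    then show "sq_integrable M (\<lambda>\<omega>. X n \<omega> - Y \<omega>)" by (simp add: sq_integrable_def)
    show "(\<integral>\<omega>. (X n \<omega> - Y \<omega>)\<^sup>2 \<partial>M) \<le> e"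
      using bound[OF that(1)] nn_integral_eq_integral[OF i] that(2) by simp
  qed
  obtain N where "\<forall>n\<ge>N. \<forall>m\<ge>N. v n m < 1" using cauchy[of 1] by auto
  then have "sq_integrable M (\<lambda>\<omega>. X N \<omega> - Y \<omega>)" by (intro sqD[of N N 1]) auto
  from sq_integrable_diff[OF sqX[of N] this] show "sq_integrable M Y" by simp
  show "(\<lambda>n. \<integral>\<omega>. (X n \<omega> - Y \<omega>)\<^sup>2 \<partial>M) \<longlonglongrightarrow> 0"
  proof (rule LIMSEQ_I)
    fix r :: real assume "0 < r"
    then obtain N where N: "\<forall>n\<ge>N. \<forall>m\<ge>N. v n m < r / 2" using cauchy[of "r/2"] by auto
    have "norm ((\<integral>\<omega>. (X n \<omega> - Y \<omega>)\<^sup>2 \<partial>M) - 0) < r" if "n \<ge> N" for n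
      using iD[of N n "r/2"] N that \<open>0 < r\<close> by simp
    then show "\<exists>no. \<forall>n\<ge>no. norm ((\<integral>\<omega>. (X n \<omega> - Y \<omega>)\<^sup>2 \<partial>M) - 0) < r" by blast
  qed
qed

text \<open>The left side of the cosine identity passes to the limit by boundedness, the right side
  by mean square convergence. Thus limits of difference quotients of \<open>f\<close> form a
  Gaussian space again, and the limit theorem can be applied a second time to difference quotients
  of \<open>f'\<close>.\<close>

lemma (in prob_space) gauss_space_ae_closure:
  assumes V: "gauss_space M V"
  shows "gauss_space M (ae_closure M V)"
  unfolding gauss_space_def
proof (intro conjI ballI allI)
  fix Y assume "Y \<in> ae_closure M V"
  then obtain X where [measurable]: "Y \<in> borel_measurable M" and X: "\<And>n::nat. X n \<in> V"
    and lim: "AE \<omega> in M. (\<lambda>n. X n \<omega>) \<longlonglongrightarrow> Y \<omega>" by (auto simp: ae_closure_def)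
  note L = gauss_space_limit[OF V X _ lim]
  show "sq_integrable M Y" by (rule L) auto
  have sqX: "sq_integrable M (X n)" for n
    using V X by (rule gauss_spaceD)
  then have [measurable]: "X n \<in> borel_measurable M" for n
    unfolding sq_integrable_def by blast
  have "(\<lambda>n. \<integral>\<omega>. cos (X n \<omega>) \<partial>M) \<longlonglongrightarrow> (\<integral>\<omega>. cos (Y \<omega>) \<partial>M)"
  proof (rule integral_dominated_convergence[where w = "\<lambda>_. 1"])
    show "AE \<omega> in M. (\<lambda>n. cos (X n \<omega>)) \<longlonglongrightarrow> cos (Y \<omega>)"
      using lim by eventually_elim (rule tendsto_cos)
  qed auto
  moreover have "(\<lambda>n. \<integral>\<omega>. cos (X n \<omega>) \<partial>M) = (\<lambda>n. exp (- (\<integral>\<omega>. (X n \<omega>)\<^sup>2 \<partial>M) / 2))"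
    using V X by (simp add: gauss_space_def)
  moreover have "(\<lambda>n. exp (- (\<integral>\<omega>. (X n \<omega>)\<^sup>2 \<partial>M) / 2)) \<longlonglongrightarrow> exp (- (\<integral>\<omega>. (Y \<omega>)\<^sup>2 \<partial>M) / 2)"
    by (intro tendsto_intros integral_square_tendsto sqX L) auto
  ultimately show "(\<integral>\<omega>. cos (Y \<omega>) \<partial>M) = exp (- (\<integral>\<omega>. (Y \<omega>)\<^sup>2 \<partial>M) / 2)"
    using LIMSEQ_unique by metis
next
  fix Y Y' a b assume "Y \<in> ae_closure M V" "Y' \<in> ae_closure M V"
  then obtain X X' where [measurable]: "Y \<in> borel_measurable M" "Y' \<in> borel_measurable M"
    and X: "\<And>n::nat. X n \<in> V" "\<And>n::nat. X' n \<in> V"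
    and lim: "AE \<omega> in M. (\<lambda>n. X n \<omega>) \<longlonglongrightarrow> Y \<omega>" "AE \<omega> in M. (\<lambda>n. X' n \<omega>) \<longlonglongrightarrow> Y' \<omega>"
    by (auto simp: ae_closure_def)
  have "AE \<omega> in M. (\<lambda>n. a * X n \<omega> + b * X' n \<omega>) \<longlonglongrightarrow> a * Y \<omega> + b * Y' \<omega>"
    using lim by eventually_elim (intro tendsto_intros)
  moreover have "(\<lambda>\<omega>. a * X n \<omega> + b * X' n \<omega>) \<in> V" for n
    using V X unfolding gauss_space_def by blast
  ultimately show "(\<lambda>\<omega>. a * Y \<omega> + b * Y' \<omega>) \<in> ae_closure M V"
    unfolding ae_closure_def by (auto intro!: exI[of _ "\<lambda>n \<omega>. a * X n \<omega> + b * X' n \<omega>"])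
qed

lemma (in prob_space) gaussian_rv_centered:
  assumes g: "gaussian_rv M X" and c: "expectation X = 0"
  shows "sq_integrable M X" and "expectation (\<lambda>\<omega>. cos (X \<omega>)) = exp (- expectation (\<lambda>\<omega>. (X \<omega>)\<^sup>2) / 2)"
proof -
  have X[measurable]: "X \<in> borel_measurable M" using g by (simp add: gaussian_rv_def)
  have "sq_integrable M X \<and> expectation (\<lambda>\<omega>. cos (X \<omega>)) = exp (- expectation (\<lambda>\<omega>. (X \<omega>)\<^sup>2) / 2)"
    using g unfolding gaussian_rv_def
  proof (elim conjE disjE exE)
    fix m s :: real
    assume s: "s > 0" and D: "distributed M lborel X (normal_density m s)"
    have m: "m = 0" using normal_distributed_expectation[OF s D] c by simp
    have var: "expectation (\<lambda>\<omega>. (X \<omega>)\<^sup>2) = s\<^sup>2"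
      using normal_distributed_variance[OF s D] c by simp
    \<comment> \<open>A Bochner integral is 0 by convention when the function is not integrable,
      whereas here it equals the positive number \<open>s^2\<close>.\<close>
    have int: "integrable M (\<lambda>\<omega>. (X \<omega>)\<^sup>2)"
      using var s not_integrable_integral_eq by fastforce
    have D1: "distributed M lborel (\<lambda>\<omega>. X \<omega> / s) std_normal_density"
      using normal_standard_normal_convert[OF s, of X m] D m by simp
    have dist: "distr M borel (\<lambda>\<omega>. X \<omega> / s) = std_normal_distribution"
      using distributed_distr_eq_density[OF D1]
      by (metis distr_cong sets_lborel)
    have "char std_normal_distribution s = (CLINT \<omega>|M. iexp (s * (X \<omega> / s)))"
      unfolding dist[symmetric] char_def by (subst integral_distr) auto
    then have "(CLINT \<omega>|M. iexp (X \<omega>)) = exp (- (s\<^sup>2) / 2)"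
      using s by (simp add: char_std_normal_distribution)
    moreover have "Re (CLINT \<omega>|M. iexp (X \<omega>)) = expectation (\<lambda>\<omega>. Re (iexp (X \<omega>)))"
      by (rule integral_Re[symmetric]) (rule integrable_const_bound[where B=1], auto)
    ultimately show ?thesis
      using int var by (simp add: sq_integrable_def Re_exp)
  next
    fix m assume ae: "AE \<omega> in M. X \<omega> = m"
    then have "expectation X = expectation (\<lambda>_. m)" by (intro integral_cong_AE) auto
    then have "m = 0" using c by (simp add: prob_space)
    with ae have ae: "AE \<omega> in M. X \<omega> = 0" by simp
    have "expectation (\<lambda>\<omega>. (X \<omega>)\<^sup>2) = expectation (\<lambda>_. 0)"
      using ae by (intro integral_cong_AE) auto
    moreover have "expectation (\<lambda>\<omega>. cos (X \<omega>)) = expectation (\<lambda>_. 1)"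
      using ae by (intro integral_cong_AE) auto
    moreover have "integrable M (\<lambda>\<omega>. (X \<omega>)\<^sup>2) = integrable M (\<lambda>\<omega>. 0::real)"
      using ae by (intro integrable_cong_AE) auto
    ultimately show ?thesis by (simp add: sq_integrable_def prob_space)
  qed
  then show "sq_integrable M X" "expectation (\<lambda>\<omega>. cos (X \<omega>)) = exp (- expectation (\<lambda>\<omega>. (X \<omega>)\<^sup>2) / 2)"
    by auto
qed

definition lin_span :: "(real \<Rightarrow> 'a \<Rightarrow> real) \<Rightarrow> ('a \<Rightarrow> real) set" where
  "lin_span f = {X. \<exists>S c. finite S \<and> X = (\<lambda>\<omega>. \<Sum>x\<in>S. c x * f x \<omega>)}"

lemma (in prob_space) gauss_space_lin_span:
  assumes g: "gaussian_process M f" and c: "centered_process M f"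
  shows "gauss_space M (lin_span f)"
  unfolding gauss_space_def
proof (intro conjI ballI allI)
  fix X assume "X \<in> lin_span f"
  then obtain S u where S: "finite S" and X: "X = (\<lambda>\<omega>. \<Sum>x\<in>S. u x * f x \<omega>)"
    by (auto simp: lin_span_def)
  have 1: "gaussian_rv M X" using g S unfolding X gaussian_process_def by blast
  have 2: "expectation X = 0" unfolding X
    using c by (subst Bochner_Integration.integral_sum) (auto simp: centered_process_def)
  show "sq_integrable M X" "expectation (\<lambda>\<omega>. cos (X \<omega>)) = exp (- expectation (\<lambda>\<omega>. (X \<omega>)\<^sup>2) / 2)"
    using gaussian_rv_centered[OF 1 2] by auto
next
  fix X Y a b assume "X \<in> lin_span f" "Y \<in> lin_span f"
  then obtain S u T v where S: "finite S" and X: "X = (\<lambda>\<omega>. \<Sum>x\<in>S. u x * f x \<omega>)"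
    and T: "finite T" and Y: "Y = (\<lambda>\<omega>. \<Sum>x\<in>T. v x * f x \<omega>)"
    by (auto simp: lin_span_def)
  define w where "w x = a * (if x \<in> S then u x else 0) + b * (if x \<in> T then v x else 0)" for x
  have "(\<lambda>\<omega>. a * X \<omega> + b * Y \<omega>) = (\<lambda>\<omega>. \<Sum>x\<in>S \<union> T. w x * f x \<omega>)"
  proof
    fix \<omega>
    have "(\<Sum>x\<in>S. u x * f x \<omega>) = (\<Sum>x\<in>S \<union> T. (if x \<in> S then u x else 0) * f x \<omega>)"
      by (rule sum.mono_neutral_cong_left) (use S T in auto)
    moreover have "(\<Sum>x\<in>T. v x * f x \<omega>) = (\<Sum>x\<in>S \<union> T. (if x \<in> T then v x else 0) * f x \<omega>)"
      by (rule sum.mono_neutral_cong_left) (use S T in auto)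
    ultimately show "a * X \<omega> + b * Y \<omega> = (\<Sum>x\<in>S \<union> T. w x * f x \<omega>)"
      unfolding X Y w_def by (simp add: sum_distrib_left sum.distrib algebra_simps)
  qed
  then show "(\<lambda>\<omega>. a * X \<omega> + b * Y \<omega>) \<in> lin_span f"
    unfolding lin_span_def using S T by blast
qed

section \<open>The correlation function of a smooth stationary Gaussian process\<close>

lemma inverse_Suc_seq:
  "(\<lambda>n. 1 / real (Suc n)) \<longlonglongrightarrow> 0" "1 / real (Suc n) \<noteq> 0"
  using LIMSEQ_inverse_real_of_nat by (simp_all add: inverse_eq_divide)

lemma DERIV_seq:
  fixes g :: "real \<Rightarrow> real"
  assumes "(g has_field_derivative d) (at t)" "h \<longlonglongrightarrow> 0" "\<And>n. h n \<noteq> 0"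
  shows "(\<lambda>n. (g (t + h n) - g t) / h n) \<longlonglongrightarrow> d"
proof -
  have "((\<lambda>h. (g (t + h) - g t) / h) \<longlongrightarrow> d) (at 0)"
    using assms(1) by (simp add: DERIV_def)
  then show ?thesis
    using assms(2,3) unfolding tendsto_at_iff_sequentially by (auto simp: o_def)
qed

text \<open>The Gaussian limit theorem concerns sequences, so derivatives of expectations are tested
  along arbitrary null sequences of increments.\<close>

lemma DERIV_seqI:
  fixes g :: "real \<Rightarrow> real"
  assumes "\<And>h. h \<longlonglongrightarrow> 0 \<Longrightarrow> (\<And>n. h n \<noteq> 0) \<Longrightarrow> (\<lambda>n. (g (t + h n) - g t) / h n) \<longlonglongrightarrow> d"
  shows "(g has_field_derivative d) (at t)"
  unfolding DERIV_def tendsto_at_iff_sequentially using assms by (auto simp: o_def)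

locale smooth_stationary_gaussian = prob_space M for M :: "'a measure" +
  fixes f :: "real \<Rightarrow> 'a \<Rightarrow> real"
  assumes gaussian: "gaussian_process M f"
    and centered: "centered_process M f"
    and stationary: "stationary_process M f"
    and class_C2: "process_class_C 2 M f"
    and normalized: "normalized_process M f"
begin

abbreviation "\<kappa> \<equiv> correlation M f"

text \<open>A limit of difference quotients agrees almost surely with the path derivative, and is
  measurable even if \<open>M\<close> is not complete.\<close>

definition f' :: "real \<Rightarrow> 'a \<Rightarrow> real" where
  "f' t \<omega> = lim (\<lambda>n. (f (t + 1 / real (Suc n)) \<omega> - f t \<omega>) / (1 / real (Suc n)))"

definition f''0 :: "'a \<Rightarrow> real" where
  "f''0 \<omega> = lim (\<lambda>n. (f' (1 / real (Suc n)) \<omega> - f' 0 \<omega>) / (1 / real (Suc n)))"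

definition \<kappa>' :: "real \<Rightarrow> real" where "\<kappa>' t = expectation (\<lambda>\<omega>. f' t \<omega> * f 0 \<omega>)"

definition \<kappa>'' :: "real \<Rightarrow> real" where "\<kappa>'' t = - expectation (\<lambda>\<omega>. f' (- t) \<omega> * f' 0 \<omega>)"

lemma f_measurable[measurable]: "f t \<in> borel_measurable M"
  using centered by (auto simp: centered_process_def)

lemma f'_measurable[measurable]: "f' t \<in> borel_measurable M"
  unfolding f'_def[abs_def] by measurable

lemma f''0_measurable[measurable]: "f''0 \<in> borel_measurable M"
  unfolding f''0_def[abs_def] by measurable

text \<open>A single null set serves all \<open>t\<close>, since being of class C^2 is a property of
  the whole trajectory. This matters for the second conjunct, which involves \<open>f'\<close> at
  uncountably many points.\<close>

lemma path_derivatives: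
  "AE \<omega> in M. (\<forall>t. ((\<lambda>x. f x \<omega>) has_field_derivative f' t \<omega>) (at t)) \<and>
     ((\<lambda>x. f' x \<omega>) has_field_derivative f''0 \<omega>) (at 0)"
  using class_C2 unfolding process_class_C_def
proof eventually_elim
  case (elim \<omega>)
  define g where "g x = f x \<omega>" for x
  have dk: "(deriv ^^ k) g differentiable (at x)" if "k < 2" for k x
    using elim that unfolding class_C_def g_def[abs_def] by blast
  have g1: "(g has_field_derivative deriv g t) (at t)" for t
    using dk[of 0 t] DERIV_deriv_iff_real_differentiable by auto
  have g2: "(deriv g has_field_derivative deriv (deriv g) t) (at t)" for t
    using dk[of 1 t] DERIV_deriv_iff_real_differentiable by auto
  have f': "f' t \<omega> = deriv g t" for t
    unfolding f'_def using DERIV_seq[OF g1 inverse_Suc_seq] by (intro limI) (simp add: g_def)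
  have f'': "f''0 \<omega> = deriv (deriv g) 0"
    unfolding f''0_def f' using DERIV_seq[OF g2[of 0] inverse_Suc_seq] by (intro limI) simp
  show ?case
    using g1 g2[of 0] by (simp add: f' f'' g_def[abs_def])
qed

abbreviation "V\<^sub>0 \<equiv> lin_span f"
abbreviation "V\<^sub>1 \<equiv> ae_closure M V\<^sub>0"

lemma gauss_V0: "gauss_space M V\<^sub>0"
  using gaussian centered by (rule gauss_space_lin_span)

lemma gauss_V1: "gauss_space M V\<^sub>1"
  using gauss_V0 by (rule gauss_space_ae_closure)

lemma f_in_V0: "f t \<in> V\<^sub>0"
  unfolding lin_span_def by (auto intro!: exI[of _ "{t}"] exI[of _ "\<lambda>_. 1"])

lemma diffquot_in_V0: "(\<lambda>\<omega>. (f s \<omega> - f t \<omega>) / h) \<in> V\<^sub>0"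
  using gauss_space_lincomb[OF gauss_V0 f_in_V0 f_in_V0, of "1/h" s "-1/h" t]
  by (simp add: diff_divide_distrib)

lemma diffquot_f_AE:
  assumes "h \<longlonglongrightarrow> 0" "\<And>n. h n \<noteq> 0"
  shows "AE \<omega> in M. (\<lambda>n. (f (t + h n) \<omega> - f t \<omega>) / h n) \<longlonglongrightarrow> f' t \<omega>"
  using path_derivatives by eventually_elim (use DERIV_seq assms in blast)

lemma f'_in_V1: "f' t \<in> V\<^sub>1"
  unfolding ae_closure_def
  by (auto intro!: exI[of _ "\<lambda>n \<omega>. (f (t + 1 / real (Suc n)) \<omega> - f t \<omega>) / (1 / real (Suc n))"]
    simp del: of_nat_Suc intro: diffquot_in_V0 diffquot_f_AE inverse_Suc_seq)

lemma sq_f: "sq_integrable M (f t)"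
  using gauss_V0 f_in_V0 by (rule gauss_spaceD)

lemma sq_f': "sq_integrable M (f' t)"
  using gauss_V1 f'_in_V1 by (rule gauss_spaceD)

text \<open>Differentiation under the expectation: the difference quotients are Gaussian and
  converge almost surely, hence in mean square, and pairing with a fixed square integrable
  \<open>Z\<close> is continuous for that convergence.\<close>

lemma DERIV_expectation_f:
  assumes Z: "sq_integrable M Z"
  shows "((\<lambda>t. expectation (\<lambda>\<omega>. f t \<omega> * Z \<omega>)) has_field_derivative
    expectation (\<lambda>\<omega>. f' t \<omega> * Z \<omega>)) (at t)"
proof (rule DERIV_seqI)
  fix h :: "nat \<Rightarrow> real" assume h: "h \<longlonglongrightarrow> 0" "\<And>n. h n \<noteq> 0"
  define X where "X n \<omega> = (f (t + h n) \<omega> - f t \<omega>) / h n" for n \<omega>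
  have X: "X n \<in> V\<^sub>0" for n unfolding X_def[abs_def] by (rule diffquot_in_V0)
  have "(\<lambda>n. expectation (\<lambda>\<omega>. X n \<omega> * Z \<omega>)) \<longlonglongrightarrow> expectation (\<lambda>\<omega>. f' t \<omega> * Z \<omega>)"
  proof (rule integral_mult_tendsto[OF gauss_spaceD(1)[OF gauss_V0 X] sq_f' Z])
    show "(\<lambda>n. expectation (\<lambda>\<omega>. (X n \<omega> - f' t \<omega>)\<^sup>2)) \<longlonglongrightarrow> 0"
      by (rule gauss_space_limit[OF gauss_V0 X]) (use diffquot_f_AE[OF h] in \<open>auto simp: X_def\<close>)
  qed
  moreover have "expectation (\<lambda>\<omega>. X n \<omega> * Z \<omega>)
      = (expectation (\<lambda>\<omega>. f (t + h n) \<omega> * Z \<omega>) - expectation (\<lambda>\<omega>. f t \<omega> * Z \<omega>)) / h n" for n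
    using integral_lincomb_mult[OF sq_f sq_f Z, of "1 / h n" "t + h n" "- 1 / h n" t]
    by (simp add: X_def diff_divide_distrib)
  ultimately show "(\<lambda>n. (expectation (\<lambda>\<omega>. f (t + h n) \<omega> * Z \<omega>) - expectation (\<lambda>\<omega>. f t \<omega> * Z \<omega>)) / h n)
      \<longlonglongrightarrow> expectation (\<lambda>\<omega>. f' t \<omega> * Z \<omega>)"
    by simp
qed

text \<open>Stationarity speaks of laws on the product space, so it is applied to the functional
  sending \<open>g\<close> to \<open>g 0 * g (t - s)\<close>, for the process shifted by
  \<open>s\<close>.\<close>

lemma expectation_ff: "expectation (\<lambda>\<omega>. f s \<omega> * f t \<omega>) = \<kappa> (t - s)"
proof -
  let ?P = "\<Pi>\<^sub>M x\<in>(UNIV::real set). (borel :: real measure)"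
  have m: "(\<lambda>\<omega> x. f (x + h) \<omega>) \<in> measurable M ?P" for h
    by (rule measurable_PiM_single') auto
  have "expectation (\<lambda>\<omega>. f s \<omega> * f t \<omega>)
      = integral\<^sup>L (distr M ?P (\<lambda>\<omega> x. f (x + s) \<omega>)) (\<lambda>g. g 0 * g (t - s))"
    by (subst integral_distr[OF m]) auto
  also have "distr M ?P (\<lambda>\<omega> x. f (x + s) \<omega>) = distr M ?P (\<lambda>\<omega> x. f (x + 0) \<omega>)"
    using stationary by (simp add: stationary_process_def)
  also have "integral\<^sup>L \<dots> (\<lambda>g. g 0 * g (t - s)) = \<kappa> (t - s)"
    unfolding correlation_def by (subst integral_distr[OF m]) auto
  finally show ?thesis .
qed

lemma \<kappa>_even: "\<kappa> (- t) = \<kappa> t"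
  using expectation_ff[of 0 t] expectation_ff[of t 0] by (simp add: mult.commute)

lemma DERIV_\<kappa>: "(\<kappa> has_field_derivative \<kappa>' t) (at t)"
proof -
  have "expectation (\<lambda>\<omega>. f t \<omega> * f 0 \<omega>) = \<kappa> t" for t
    using expectation_ff[of t 0] by (simp add: \<kappa>_even)
  then show ?thesis
    using DERIV_expectation_f[OF sq_f[of 0]] unfolding \<kappa>'_def by simp
qed

lemma \<kappa>'_odd: "\<kappa>' (- t) = - \<kappa>' t"
proof -
  have "((\<lambda>t. \<kappa> (- t)) has_field_derivative \<kappa>' (-t) * (-1)) (at t)"
    by (rule DERIV_chain2[OF DERIV_\<kappa>]) (auto intro!: derivative_eq_intros)
  then have "(\<kappa> has_field_derivative - \<kappa>' (-t)) (at t)" by (simp add: \<kappa>_even)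
  from DERIV_unique[OF this DERIV_\<kappa>] show ?thesis by simp
qed

text \<open>Differentiating the covariance of \<open>f t\<close> and \<open>f s\<close> in
  \<open>t\<close>, once as a function of \<open>s - t\<close> and once in mean square, gives two
  derivatives that must agree.\<close>

lemma expectation_f'f: "expectation (\<lambda>\<omega>. f' t \<omega> * f s \<omega>) = \<kappa>' (t - s)"
proof -
  have "((\<lambda>t. \<kappa> (s - t)) has_field_derivative \<kappa>' (s - t) * (-1)) (at t)"
    by (rule DERIV_chain2[OF DERIV_\<kappa>]) (auto intro!: derivative_eq_intros)
  moreover have "((\<lambda>t. \<kappa> (s - t)) has_field_derivative expectation (\<lambda>\<omega>. f' t \<omega> * f s \<omega>)) (at t)"
    using DERIV_expectation_f[OF sq_f[of s]] by (simp add: expectation_ff)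
  ultimately have "expectation (\<lambda>\<omega>. f' t \<omega> * f s \<omega>) = \<kappa>' (s - t) * (-1)"
    by (rule DERIV_unique[symmetric])
  then show ?thesis using \<kappa>'_odd[of "t - s"] by simp
qed

lemma DERIV_\<kappa>'_shift: 
  "((\<lambda>s. \<kappa>' (t - s)) has_field_derivative expectation (\<lambda>\<omega>. f' s \<omega> * f' t \<omega>)) (at s)"
proof -
  have "expectation (\<lambda>\<omega>. f s \<omega> * f' t \<omega>) = \<kappa>' (t - s)" for s
    using expectation_f'f[of t s] by (simp add: mult.commute)
  then show ?thesis using DERIV_expectation_f[OF sq_f'[of t]] by simp
qed

lemma DERIV_\<kappa>': "(\<kappa>' has_field_derivative \<kappa>'' t) (at t)"
proof -
  have "((\<lambda>t. - \<kappa>' (0 - t)) has_field_derivative - expectation (\<lambda>\<omega>. f' t \<omega> * f' 0 \<omega>)) (at t)" for t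
    by (intro DERIV_minus DERIV_\<kappa>'_shift)
  then have *: "(\<kappa>' has_field_derivative - expectation (\<lambda>\<omega>. f' t \<omega> * f' 0 \<omega>)) (at t)" for t
    by (simp add: \<kappa>'_odd)
  have "((\<lambda>t. - \<kappa>' (- t)) has_field_derivative - (- expectation (\<lambda>\<omega>. f' (- t) \<omega> * f' 0 \<omega>) * (-1))) (at t)"
    by (intro DERIV_minus DERIV_chain2[OF *]) (auto intro!: derivative_eq_intros)
  then show ?thesis by (simp add: \<kappa>'_odd \<kappa>''_def)
qed

lemma expectation_f'f': "expectation (\<lambda>\<omega>. f' s \<omega> * f' t \<omega>) = - \<kappa>'' (t - s)"
proof -
  have "((\<lambda>s. \<kappa>' (t - s)) has_field_derivative \<kappa>'' (t - s) * (-1)) (at s)"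
    by (rule DERIV_chain2[OF DERIV_\<kappa>']) (auto intro!: derivative_eq_intros)
  from DERIV_unique[OF DERIV_\<kappa>'_shift this] show ?thesis by simp
qed

lemma \<kappa>''_even: "\<kappa>'' (- t) = \<kappa>'' t"
  using expectation_f'f'[of 0 t] expectation_f'f'[of t 0] by (simp add: mult.commute)

lemma deriv_\<kappa>: "deriv \<kappa> = \<kappa>'"
  using DERIV_\<kappa> by (auto intro: DERIV_imp_deriv)

lemma deriv2_\<kappa>: "(deriv ^^ 2) \<kappa> = \<kappa>''"
  using DERIV_\<kappa>' by (auto simp: numeral_2_eq_2 deriv_\<kappa> intro: DERIV_imp_deriv)

lemma \<kappa>_at_0: "\<kappa> 0 = 1" "\<kappa>' 0 = 0" "\<kappa>'' 0 = -1"
  using normalized \<kappa>'_odd[of 0] by (auto simp: normalized_process_def deriv2_\<kappa>)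

text \<open>This is the quadratic form of the covariance matrix of f(0), f'(0), f(t), f'(t). The
  factors 1 give the sum the shape of \<open>integral_lincomb_square\<close>.\<close>

lemma expectation_combination_square:
  defines "Y t a b c d \<equiv> (\<lambda>\<omega>. 1 * (a * f 0 \<omega> + b * f' 0 \<omega>) + 1 * (c * f t \<omega> + d * f' t \<omega>))"
  shows "expectation (\<lambda>\<omega>. (Y t a b c d \<omega>)\<^sup>2) = a\<^sup>2 + b\<^sup>2 + c\<^sup>2 + d\<^sup>2
     + 2 * (a * c * \<kappa> t + a * d * \<kappa>' t - b * c * \<kappa>' t - b * d * \<kappa>'' t)"
proof -
  note sq = sq_f sq_f' sq_integrable_lincomb[OF sq_f sq_f']
  have ff': "expectation (\<lambda>\<omega>. f s \<omega> * f' t \<omega>) = \<kappa>' (t - s)" for s t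
    using expectation_f'f[of t s] by (simp add: mult.commute)
  have cross: "expectation (\<lambda>\<omega>. (a * f 0 \<omega> + b * f' 0 \<omega>) * (c * f t \<omega> + d * f' t \<omega>))
      = a * c * \<kappa> t + a * d * \<kappa>' t - b * c * \<kappa>' t - b * d * \<kappa>'' t"
    unfolding integral_lincomb_mult[OF sq_f sq_f' sq(3)] integral_mult_lincomb[OF sq_f sq_f' sq_f]
      integral_mult_lincomb[OF sq_f sq_f' sq_f'] expectation_ff expectation_f'f expectation_f'f' ff'
    by (simp add: \<kappa>'_odd algebra_simps)
  have s2: "expectation (\<lambda>\<omega>. (f t \<omega>)\<^sup>2) = 1" "expectation (\<lambda>\<omega>. (f' t \<omega>)\<^sup>2) = 1" for t
    using expectation_ff[of t t] expectation_f'f'[of t t] by (simp_all add: \<kappa>_at_0 power2_eq_square)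
  show ?thesis
    unfolding Y_def
    unfolding integral_lincomb_square[OF sq(3) sq(3)] integral_lincomb_square[OF sq_f sq_f'] cross ff' s2
    by (simp add: \<kappa>_at_0)
qed

text \<open>Suitable coefficients turn this one inequality into \<open>D\<close> being nonnegative,
  the second derivative of the correlation being at most 1 in absolute value, and the bounds on
  \<open>a\<close>.\<close>

lemma covariance_nonneg:
  "0 \<le> a\<^sup>2 + b\<^sup>2 + c\<^sup>2 + d\<^sup>2
     + 2 * (a * c * \<kappa> t + a * d * \<kappa>' t - b * c * \<kappa>' t - b * d * \<kappa>'' t)"
  unfolding expectation_combination_square[symmetric] by simp

text \<open>A substitute for the fourth derivative at 0: the ratio is the second moment of (f'(h) -
  f'(0)) / h, and these quotients converge almost surely inside the Gaussian space
  \<open>V\<^sub>1\<close>.\<close>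

lemma \<kappa>''_near_0: "((\<lambda>h. 2 * (1 + \<kappa>'' h) / h\<^sup>2) \<longlongrightarrow> expectation (\<lambda>\<omega>. (f''0 \<omega>)\<^sup>2)) (at 0)"
  unfolding tendsto_at_iff_sequentially
proof (intro allI impI)
  fix h :: "nat \<Rightarrow> real" assume h: "\<forall>n. h n \<in> UNIV - {0}" "h \<longlonglongrightarrow> 0"
  define X where "X n \<omega> = (f' (0 + h n) \<omega> - f' 0 \<omega>) / h n" for n \<omega>
  have Xe: "X n = (\<lambda>\<omega>. 1 / h n * f' (h n) \<omega> + (- 1 / h n) * f' 0 \<omega>)" for n
    by (simp add: X_def fun_eq_iff diff_divide_distrib)
  have X: "X n \<in> V\<^sub>1" for n
    unfolding Xe by (rule gauss_space_lincomb[OF gauss_V1 f'_in_V1 f'_in_V1])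
  have ae: "AE \<omega> in M. (\<lambda>n. X n \<omega>) \<longlonglongrightarrow> f''0 \<omega>"
    using path_derivatives unfolding X_def
    by eventually_elim (use DERIV_seq h in blast)
  note L = gauss_space_limit[OF gauss_V1 X f''0_measurable ae]
  have "(\<lambda>n. expectation (\<lambda>\<omega>. (X n \<omega>)\<^sup>2)) \<longlonglongrightarrow> expectation (\<lambda>\<omega>. (f''0 \<omega>)\<^sup>2)"
    by (intro integral_square_tendsto L gauss_spaceD[OF gauss_V1 X])
  moreover have "expectation (\<lambda>\<omega>. (X n \<omega>)\<^sup>2) = 2 * (1 + \<kappa>'' (h n)) / (h n)\<^sup>2" for n
    unfolding Xe integral_lincomb_square[OF sq_f' sq_f']
    using expectation_f'f'[of 0 0] expectation_f'f'[of "h n" "h n"] \<kappa>''_even[of "h n"]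
    by (simp add: expectation_f'f' \<kappa>_at_0 power2_eq_square add_divide_distrib)
  ultimately show "((\<lambda>h. 2 * (1 + \<kappa>'' h) / h\<^sup>2) \<circ> h) \<longlonglongrightarrow> expectation (\<lambda>\<omega>. (f''0 \<omega>)\<^sup>2)"
    by (simp add: o_def)
qed

text \<open>Cauchy-Schwarz for the increment of \<open>f'\<close> against \<open>f' 0\<close>, which
  has variance 1. By stationarity the bound depends on \<open>h\<close> alone, so continuity at 0
  spreads to every \<open>t\<close>.\<close>

lemma \<kappa>''_increment: "(\<kappa>'' (t + h) - \<kappa>'' t)\<^sup>2 \<le> 2 * (1 + \<kappa>'' h)"
proof -
  have "expectation (\<lambda>\<omega>. (1 * f' (t + h) \<omega> + (-1) * f' t \<omega>) * f' 0 \<omega>) = \<kappa>'' t - \<kappa>'' (t + h)"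
    by (subst integral_lincomb_mult[OF sq_f' sq_f' sq_f']) (use \<kappa>''_even[of "t + h"] \<kappa>''_even[of t] in \<open>simp add: expectation_f'f'\<close>)
  moreover have "expectation (\<lambda>\<omega>. (1 * f' (t + h) \<omega> + (-1) * f' t \<omega>)\<^sup>2) = 2 * (1 + \<kappa>'' h)"
    by (subst integral_lincomb_square[OF sq_f' sq_f'])
      (simp add: power2_eq_square expectation_f'f' \<kappa>''_even \<kappa>_at_0)
  moreover have "expectation (\<lambda>\<omega>. (f' 0 \<omega>)\<^sup>2) = 1"
    using expectation_f'f'[of 0 0] by (simp add: power2_eq_square \<kappa>_at_0)
  ultimately show ?thesis
    using integral_Cauchy_Schwarz[OF sq_integrable_lincomb[OF sq_f'[of "t+h"] sq_f'[of t], of 1 "-1"] sq_f'[of 0]]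
    by (simp add: power2_commute)
qed

lemma isCont_\<kappa>'': "isCont \<kappa>'' t"
proof -
  have "((\<lambda>h. 2 * (1 + \<kappa>'' h) / h\<^sup>2 * h\<^sup>2) \<longlongrightarrow> expectation (\<lambda>\<omega>. (f''0 \<omega>)\<^sup>2) * 0\<^sup>2) (at 0)"
    by (intro tendsto_mult \<kappa>''_near_0 tendsto_power tendsto_ident_at)
  moreover have "\<forall>\<^sub>F h in at 0. 2 * (1 + \<kappa>'' h) / h\<^sup>2 * h\<^sup>2 = 2 * (1 + \<kappa>'' h)"
    by (auto simp: eventually_at intro!: exI[of _ 1])
  ultimately have "((\<lambda>h. 2 * (1 + \<kappa>'' h)) \<longlongrightarrow> 0) (at 0)"
    using tendsto_cong by fastforce
  then have "((\<lambda>h. (\<kappa>'' (t + h) - \<kappa>'' t)\<^sup>2) \<longlongrightarrow> 0) (at 0)"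
    by (rule tendsto_sandwich[rotated 3])
      (rule always_eventually allI \<kappa>''_increment zero_le_power2 tendsto_const)+
  from tendsto_real_sqrt[OF this] have "((\<lambda>h. \<kappa>'' (t + h) - \<kappa>'' t) \<longlongrightarrow> 0) (at 0)"
    by (simp add: tendsto_rabs_zero_iff)
  then show ?thesis by (simp add: isCont_iff LIM_zero_iff)
qed

text \<open>If the expression vanishes, then f(0) is in mean square the combination of f(t) and
  f'(t) with coefficients \<open>\<kappa> t\<close> and \<open>\<kappa>' t\<close>, and stationarity
  shifts this relation to every time. Taking covariances of the shifted relations yields both
  identities.\<close>

lemma degenerate:
  assumes D: "1 - (\<kappa> t)\<^sup>2 - (\<kappa>' t)\<^sup>2 = 0"
  shows "\<kappa> s = (\<kappa> t)\<^sup>2 * \<kappa> s - (\<kappa>' t)\<^sup>2 * \<kappa>'' s"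
    and "\<kappa>' t = 0 \<Longrightarrow> \<kappa> s = \<kappa> t * \<kappa> (s - t)"
proof -
  define c d where "c = \<kappa> t" and "d = \<kappa>' t"
  \<comment> \<open>\<open>W s\<close> is the orthogonal projection of \<open>f s\<close> onto the
    span of \<open>f (t + s)\<close> and \<open>f' (t + s)\<close>, which are orthogonal and of unit
    variance; the coefficients are the covariances with \<open>f s\<close>.\<close>
  define W where "W s \<omega> = c * f (t + s) \<omega> + d * f' (t + s) \<omega>" for s \<omega>
  have sqW: "sq_integrable M (W s)" for s
    unfolding W_def[abs_def] by (intro sq_integrable_lincomb sq_f sq_f')
  have ff': "expectation (\<lambda>\<omega>. f s \<omega> * f' t \<omega>) = \<kappa>' (t - s)" for s t
    using expectation_f'f[of t s] by (simp add: mult.commute)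
  have Wf: "expectation (\<lambda>\<omega>. W s \<omega> * f u \<omega>) = c * \<kappa> (u - t - s) - d * \<kappa>' (u - t - s)" for s u
    unfolding W_def integral_lincomb_mult[OF sq_f sq_f' sq_f] expectation_ff expectation_f'f
    using \<kappa>'_odd[of "t + s - u"] by (simp add: diff_diff_eq)
  have Wf': "expectation (\<lambda>\<omega>. W s \<omega> * f' u \<omega>) = c * \<kappa>' (u - t - s) - d * \<kappa>'' (u - t - s)" for s u
    unfolding W_def integral_lincomb_mult[OF sq_f sq_f' sq_f'] expectation_f'f' ff'
    by (simp add: diff_diff_eq)
  have WW: "expectation (\<lambda>\<omega>. W 0 \<omega> * W s \<omega>) = c\<^sup>2 * \<kappa> s - d\<^sup>2 * \<kappa>'' s" for s
  proof -
    have "expectation (\<lambda>\<omega>. W 0 \<omega> * W s \<omega>)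
        = expectation (\<lambda>\<omega>. (c * f (t + s) \<omega> + d * f' (t + s) \<omega>) * W 0 \<omega>)"
      by (simp add: W_def mult.commute)
    also have "\<dots> = c * expectation (\<lambda>\<omega>. W 0 \<omega> * f (t + s) \<omega>) + d * expectation (\<lambda>\<omega>. W 0 \<omega> * f' (t + s) \<omega>)"
      by (subst integral_lincomb_mult[OF sq_f sq_f' sqW]) (simp add: mult.commute)
    also have "\<dots> = c\<^sup>2 * \<kappa> s - d\<^sup>2 * \<kappa>'' s"
      unfolding Wf Wf' by (simp add: power2_eq_square algebra_simps)
    finally show ?thesis .
  qed
  \<comment> \<open>The residual of the projection has second moment 1 - c^2 - d^2, which is 0 by
    the assumption \<open>D\<close>.\<close>
  have "expectation (\<lambda>\<omega>. (1 * f s \<omega> + (-1) * W s \<omega>)\<^sup>2) = 0" for s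
  proof -
    have *: "expectation (\<lambda>\<omega>. f s \<omega> * W s \<omega>) = c\<^sup>2 + d\<^sup>2"
      using Wf[of s s] \<kappa>'_odd[of t] \<kappa>_even[of t]
      by (simp add: mult.commute c_def d_def power2_eq_square)
    have W2: "expectation (\<lambda>\<omega>. (W s \<omega>)\<^sup>2) = c\<^sup>2 + d\<^sup>2"
      unfolding W_def
      by (subst integral_lincomb_square[OF sq_f sq_f'])
        (use expectation_ff[of "t+s" "t+s"] expectation_f'f'[of "t+s" "t+s"] ff'[of "t+s" "t+s"]
          in \<open>simp add: \<kappa>_at_0 power2_eq_square\<close>)
    have f2: "expectation (\<lambda>\<omega>. (f s \<omega>)\<^sup>2) = 1"
      using expectation_ff[of s s] by (simp add: \<kappa>_at_0 power2_eq_square)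
    show ?thesis
      by (subst integral_lincomb_square[OF sq_f sqW])
        (use D in \<open>simp add: * W2 f2 c_def d_def\<close>)
  qed
  then have Y0: "(expectation (\<lambda>\<omega>. (1 * f s \<omega> + (-1) * W s \<omega>) * Z \<omega>))\<^sup>2 \<le> 0"
    if "sq_integrable M Z" for Z s
    using integral_Cauchy_Schwarz[OF sq_integrable_lincomb[OF sq_f[of s] sqW[of s], of 1 "-1"] that] by simp
  have fW: "expectation (\<lambda>\<omega>. f s \<omega> * Z \<omega>) = expectation (\<lambda>\<omega>. W s \<omega> * Z \<omega>)"
    if "sq_integrable M Z" for Z s
    using Y0[OF that, of s] unfolding integral_lincomb_mult[OF sq_f sqW that] by simp
  have "\<kappa> s = expectation (\<lambda>\<omega>. W 0 \<omega> * f s \<omega>)"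
    using fW[OF sq_f, of 0 s] by (simp add: expectation_ff)
  then have 1: "\<kappa> s = c * \<kappa> (s - t) - d * \<kappa>' (s - t)" and
    2: "\<kappa> s = expectation (\<lambda>\<omega>. f s \<omega> * W 0 \<omega>)"
    unfolding Wf by (simp_all add: Wf mult.commute)
  show "\<kappa>' t = 0 \<Longrightarrow> \<kappa> s = \<kappa> t * \<kappa> (s - t)" using 1 by (simp add: c_def d_def)
  have "expectation (\<lambda>\<omega>. f s \<omega> * W 0 \<omega>) = expectation (\<lambda>\<omega>. W s \<omega> * W 0 \<omega>)"
    by (rule fW[OF sqW])
  then show "\<kappa> s = (\<kappa> t)\<^sup>2 * \<kappa> s - (\<kappa>' t)\<^sup>2 * \<kappa>'' s"
    using 2 WW[of s] by (simp add: c_def d_def mult.commute)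
qed

end

section \<open>Decay at infinity and nondegeneracy\<close>

lemma tail_norm_tendsto:
  assumes lim: "((\<lambda>\<eta>. tail_norm p \<eta> g) \<longlongrightarrow> 0) at_top" and l: "l \<le> p"
  shows "((deriv ^^ l) g \<longlongrightarrow> 0) at_top"
proof (rule tendstoI)
  fix e :: real assume "0 < e"
  then have "\<forall>\<^sub>F x in at_top. tail_norm p x g < ereal e"
    using lim by (intro order_tendstoD) (auto simp: zero_ereal_def)
  then show "\<forall>\<^sub>F x in at_top. dist ((deriv ^^ l) g x) 0 < e"
  proof eventually_elim
    case (elim x)
    have "ereal \<bar>(deriv ^^ l) g x\<bar> \<le> tail_norm p x g"
      unfolding tail_norm_def using l abs_ge_self[of x] by (intro Sup_upper) blast
    then have "ereal \<bar>(deriv ^^ l) g x\<bar> < ereal e" using elim by (rule order.strict_trans1)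
    then show ?case by simp
  qed
qed

text \<open>Degeneracy at a single positive time contradicts decay. If
  \<open>\<kappa>' t = 0\<close>, then \<open>\<kappa> t\<close> is 1 or -1 and the square of the
  correlation is 1 at all multiples of \<open>t\<close>. Otherwise the correlation solves the
  harmonic oscillator equation, whose energy is constantly 1.\<close>

lemma (in smooth_stationary_gaussian) nondegenerate:
  assumes lim: "(\<kappa> \<longlongrightarrow> 0) at_top" "(\<kappa>' \<longlongrightarrow> 0) at_top" and t: "0 < t"
  shows "0 < 1 - (\<kappa> t)\<^sup>2 - (\<kappa>' t)\<^sup>2"
proof (rule ccontr)
  assume "\<not> ?thesis"
  moreover have "0 \<le> 1 - (\<kappa> t)\<^sup>2 - (\<kappa>' t)\<^sup>2"
    using covariance_nonneg[of 1 0 "- \<kappa> t" "- \<kappa>' t" t] by (simp add: power2_eq_square)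
  ultimately have D: "1 - (\<kappa> t)\<^sup>2 - (\<kappa>' t)\<^sup>2 = 0" by simp
  note deg = degenerate[OF D]
  show False
  proof (cases "\<kappa>' t = 0")
    case True
    then have c: "(\<kappa> t)\<^sup>2 = 1" using D by simp
    have 1: "(\<kappa> (real n * t))\<^sup>2 = 1" for n
    proof (induction n)
      case 0 then show ?case by (simp add: \<kappa>_at_0)
    next
      case (Suc n)
      have "\<kappa> (real (Suc n) * t) = \<kappa> t * \<kappa> (real n * t)"
        using deg(2)[OF True, of "real (Suc n) * t"] by (simp add: algebra_simps)
      then show ?case using Suc c by (simp add: power_mult_distrib)
    qed
    have "filterlim (\<lambda>n. real n * t) at_top sequentially"
      using t by (intro filterlim_at_top_mult_tendsto_pos[OF tendsto_const _ filterlim_real_sequentially, of t]) 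
    from filterlim_compose[OF lim(1) this] have "(\<lambda>n. (\<kappa> (real n * t))\<^sup>2) \<longlonglongrightarrow> 0\<^sup>2"
      by (rule tendsto_power)
    then show False unfolding 1 by (simp add: LIMSEQ_const_iff)
  next
    case False
    have eq: "\<kappa> s + \<kappa>'' s = 0" for s
    proof -
      have "(\<kappa>' t)\<^sup>2 = 1 - (\<kappa> t)\<^sup>2" using D by simp
      then have "(\<kappa>' t)\<^sup>2 * (\<kappa> s + \<kappa>'' s) = (1 - (\<kappa> t)\<^sup>2) * \<kappa> s + (\<kappa>' t)\<^sup>2 * \<kappa>'' s"
        by (simp only: distrib_left)
      also have "\<dots> = 0" using deg(1)[of s] by (simp add: algebra_simps)
      finally show ?thesis using False by simp
    qed
    have "((\<lambda>s. (\<kappa> s)\<^sup>2 + (\<kappa>' s)\<^sup>2) has_field_derivative 0) (at s)" for s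
    proof -
      have "((\<lambda>s. (\<kappa> s)\<^sup>2 + (\<kappa>' s)\<^sup>2) has_field_derivative 2 * \<kappa>' s * (\<kappa> s + \<kappa>'' s)) (at s)"
        by (auto intro!: derivative_eq_intros DERIV_\<kappa> DERIV_\<kappa>' simp: algebra_simps)
      then show ?thesis by (simp add: eq)
    qed
    then have 1: "(\<kappa> s)\<^sup>2 + (\<kappa>' s)\<^sup>2 = 1" for s
      using DERIV_isconst_all[of "\<lambda>s. (\<kappa> s)\<^sup>2 + (\<kappa>' s)\<^sup>2" s 0] by (simp add: \<kappa>_at_0)
    have "((\<lambda>s. (\<kappa> s)\<^sup>2 + (\<kappa>' s)\<^sup>2) \<longlongrightarrow> 0\<^sup>2 + 0\<^sup>2) at_top"
      by (intro tendsto_intros lim)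
    then have "((\<lambda>s::real. 1::real) \<longlongrightarrow> 0) at_top" unfolding 1 by simp
    then show False by (simp add: tendsto_const_iff)
  qed
qed

section \<open>The integral inequality\<close>

text \<open>Up to the factor 2/pi this is the expectation of |X Y| for standard Gaussian variables
  with correlation \<open>a\<close>.\<close>

definition arcsin_primitive :: "real \<Rightarrow> real" where
  "arcsin_primitive a = sqrt (1 - a\<^sup>2) + a * arcsin a"

lemma sin_minus_mono: "x \<le> y \<Longrightarrow> x - sin x \<le> y - sin (y::real)"
  by (rule DERIV_nonneg_imp_nondecreasing)
    (auto intro!: exI derivative_eq_intros simp: cos_le_one)

text \<open>Substituting \<open>a = sin x\<close> avoids the endpoint singularities of the derivative of \<open>arcsin\<close>.\<close>

lemma arcsin_primitive_lower_sin:
  fixes x y :: real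
  assumes "- (pi / 2) \<le> x" "x \<le> pi / 2" "- (pi / 2) \<le> y" "y \<le> pi / 2"
  shows "cos y + y * sin y + (sin x - sin y) * y + (sin x - sin y)\<^sup>2 / 2 \<le> cos x + x * sin x"
proof -
  define g where "g z = cos z + z * sin z - (sin z - sin y) * y - (sin z - sin y)\<^sup>2 / 2" for z
  \<comment> \<open>On the interval the cosine is nonnegative and z - sin z is increasing, so the
    derivative changes sign at \<open>y\<close>, where \<open>g\<close> has its minimum.\<close>
  have d: "(g has_field_derivative cos z * ((z - sin z) - (y - sin y))) (at z)" for z
    unfolding g_def by (auto intro!: derivative_eq_intros simp: field_simps)
  have "g y \<le> g x"
  proof (cases "y \<le> x")
    case True
    then show ?thesis
    proof (rule DERIV_nonneg_imp_nondecreasing)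
      fix z assume "y \<le> z" "z \<le> x"
      then have "0 \<le> cos z * ((z - sin z) - (y - sin y))"
        using assms sin_minus_mono[of y z] by (intro mult_nonneg_nonneg cos_ge_zero) auto
      then show "\<exists>d. (g has_field_derivative d) (at z) \<and> 0 \<le> d" using d by blast
    qed
  next
    case False
    then have "x \<le> y" by simp
    then show ?thesis
    proof (rule DERIV_nonpos_imp_nonincreasing)
      fix z assume "x \<le> z" "z \<le> y"
      then have "cos z * ((z - sin z) - (y - sin y)) \<le> 0"
        using assms sin_minus_mono[of z y] by (intro mult_nonneg_nonpos cos_ge_zero) auto
      then show "\<exists>d. (g has_field_derivative d) (at z) \<and> d \<le> 0" using d by blast
    qed
  qed
  then show ?thesis by (simp add: g_def)
qed

lemma arcsin_primitive_lower:
  assumes "a \<in> {-1..1}" "b \<in> {-1..1}"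
  shows "arcsin_primitive b + (a - b) * arcsin b + (a - b)\<^sup>2 / 2 \<le> arcsin_primitive a"
proof -
  have c: "cos (arcsin x) = sqrt (1 - x\<^sup>2)" if "x \<in> {-1..1}" for x
    using that by (intro cos_arcsin) auto
  show ?thesis
    using arcsin_primitive_lower_sin[of "arcsin a" "arcsin b"] assms arcsin_bounded[of a] arcsin_bounded[of b]
    by (simp add: c arcsin_primitive_def mult.commute)
qed

lemma arcsin_primitive_ge_1:
  assumes "a \<in> {-1..1}" shows "1 \<le> arcsin_primitive a"
proof -
  have "1 + a\<^sup>2 / 2 \<le> arcsin_primitive a"
    using arcsin_primitive_lower[OF assms, of 0] by (simp add: arcsin_primitive_def)
  then show ?thesis using zero_le_power2[of a] by linarith
qed

lemma arcsin_primitive_le_3: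
  assumes "a \<in> {-1..1}" shows "arcsin_primitive a \<le> 3"
proof -
  have "\<bar>arcsin a\<bar> \<le> pi / 2" using arcsin_bounded[of a] assms by auto
  then have "\<bar>arcsin a\<bar> \<le> 2" using pi_less_4 by linarith
  then have "\<bar>a\<bar> * \<bar>arcsin a\<bar> \<le> 1 * 2" using assms by (intro mult_mono) auto
  then have "a * arcsin a \<le> 2" using abs_mult[of a "arcsin a"] abs_ge_self[of "a * arcsin a"] by linarith
  moreover have "sqrt (1 - a\<^sup>2) \<le> 1" by simp
  ultimately show ?thesis unfolding arcsin_primitive_def by linarith
qed

lemma abs_arcsin_le:
  assumes "\<bar>a\<bar> \<le> 1 / 2" shows "\<bar>arcsin a\<bar> \<le> 2 * \<bar>a\<bar>"
proof -
  have *: "arcsin x \<le> 2 * x" if "0 \<le> x" "x \<le> 1 / 2" for x :: real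
  proof -
    have "2 * 0 - arcsin 0 \<le> 2 * x - arcsin x"
    proof (rule DERIV_nonneg_imp_nondecreasing[OF that(1)])
      \<comment> \<open>The constant 2 is crude: up to 1/2 the derivative of arcsin is at most 2 /
        sqrt 3.\<close>
      fix z assume z: "0 \<le> z" "z \<le> x"
      then have "z\<^sup>2 \<le> (1 / 2)\<^sup>2" using that by (intro power_mono) auto
      then have "1 / 4 \<le> 1 - z\<^sup>2" by (simp add: power2_eq_square)
      then have "sqrt (1 / 4) \<le> sqrt (1 - z\<^sup>2)" by (rule real_sqrt_le_mono)
      then have r: "1 / 2 \<le> sqrt (1 - z\<^sup>2)" by (simp add: real_sqrt_divide)
      then have "inverse (sqrt (1 - z\<^sup>2)) \<le> 2" using le_imp_inverse_le[OF r] by simp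
      moreover have "((\<lambda>z. 2 * z - arcsin z) has_field_derivative (2 - inverse (sqrt (1 - z\<^sup>2)))) (at z)"
        using z that by (auto intro!: derivative_eq_intros)
      ultimately show "\<exists>d. ((\<lambda>z. 2 * z - arcsin z) has_field_derivative d) (at z) \<and> 0 \<le> d"
        by (intro exI conjI) auto
    qed
    then show ?thesis by simp
  qed
  have pos: "0 \<le> arcsin x" if "0 \<le> x" "x \<le> 1/2" for x
    using that arcsin_le_arcsin[of 0 x] by simp
  show ?thesis
  proof (cases "0 \<le> a")
    case True then show ?thesis using *[of a] pos[of a] assms by simp
  next
    case False
    then show ?thesis using *[of "-a"] pos[of "-a"] assms by (simp add: arcsin_minus)
  qed
qed

text \<open>The excess over 1 is quadratic near 0, which lets the integrand be dominated at infinity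
  by integrable squares.\<close>

lemma arcsin_primitive_upper:
  assumes "\<bar>a\<bar> \<le> 1 / 2" shows "arcsin_primitive a \<le> 1 + 2 * a\<^sup>2"
proof -
  have "a * arcsin a \<le> \<bar>a\<bar> * \<bar>arcsin a\<bar>" by (simp add: abs_mult[symmetric])
  also have "\<dots> \<le> \<bar>a\<bar> * (2 * \<bar>a\<bar>)" using abs_arcsin_le[OF assms] by (intro mult_left_mono) auto
  also have "\<dots> = 2 * a\<^sup>2" by (simp add: power2_eq_square)
  finally show ?thesis by (simp add: arcsin_primitive_def add_mono)
qed

lemma powr_3_2: "0 < u \<Longrightarrow> u powr (3 / 2) = u * sqrt (u::real)"
  using powr_add[of u 1 "1/2"] by (simp add: powr_half_sqrt)

text \<open>The fundamental theorem of calculus is available on compact intervals, and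
  differentiability of \<open>P\<close> only away from 0; hence an exhaustion that recedes from both
  ends of the half-line.\<close>

lemma set_integral_exhaust:
  fixes g :: "real \<Rightarrow> real"
  assumes g: "set_integrable lborel {0<..} g"
  shows "(\<lambda>n. LBINT t:{1 / real (Suc n)..real (Suc n)}. g t) \<longlonglongrightarrow> (LBINT t:{0<..}. g t)"
  unfolding set_lebesgue_integral_def
proof (rule integral_dominated_convergence[where w = "\<lambda>t. norm (indicator {0<..} t *\<^sub>R g t)"])
  let ?J = "\<lambda>n. {1 / real (Suc n)..real (Suc n)}"
  have sub: "?J n \<subseteq> {0<..}" for n
    by (auto intro: order.strict_trans2[rotated])
  show "integrable lborel (\<lambda>t. norm (indicator {0<..} t *\<^sub>R g t))"
    using g unfolding set_integrable_def by (rule integrable_norm)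
  show "(\<lambda>t. indicator {0<..} t *\<^sub>R g t) \<in> borel_measurable lborel"
    using g unfolding set_integrable_def by auto
  show "(\<lambda>t. indicator (?J n) t *\<^sub>R g t) \<in> borel_measurable lborel" for n
    using set_integrable_subset[OF g _ sub, of n] unfolding set_integrable_def by auto
  show "AE t in lborel. norm (indicator (?J n) t *\<^sub>R g t) \<le> norm (indicator {0<..} t *\<^sub>R g t)" for n
  proof (rule AE_I2)
    fix t
    show "norm (indicator (?J n) t *\<^sub>R g t) \<le> norm (indicator {0<..} t *\<^sub>R g t)"
    proof (cases "t \<in> ?J n")
      case True
      then have "t \<in> {0<..}" using sub by blast
      with True show ?thesis by simp
    qed simp
  qed
  show "AE t in lborel. (\<lambda>n. indicator (?J n) t *\<^sub>R g t) \<longlonglongrightarrow> indicator {0<..} t *\<^sub>R g t"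
  proof (rule AE_I2)
    fix t :: real
    show "(\<lambda>n. indicator (?J n) t *\<^sub>R g t) \<longlonglongrightarrow> indicator {0<..} t *\<^sub>R g t"
    proof (cases "0 < t")
      case True
      obtain N where N: "max t (1 / t) \<le> real N" using real_arch_simple by blast
      show ?thesis
      proof (rule tendsto_eventually, rule eventually_sequentiallyI[of N])
        fix n assume "N \<le> n"
        then have n: "t \<le> real (Suc n)" "1 / t \<le> real (Suc n)" using N by auto
        then have "1 / real (Suc n) \<le> t" using True by (simp add: field_simps)
        with n(1) True show "indicator (?J n) t *\<^sub>R g t = indicator {0<..} t *\<^sub>R g t"
          by (simp add: indicator_def)
      qed
    next
      case False
      then have "t \<notin> {0<..}" by simp
      then have "t \<notin> ?J n" for n using sub by blast
      then show ?thesis using False by (simp add: indicator_def)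
    qed
  qed
qed

text \<open>These properties are all that the analytic half takes from the process.
  \<open>cov\<close> is the positivity of the covariance form, and \<open>near_0\<close> carries the
  fourth order information at the origin.\<close>

locale nondegenerate_correlation =
  fixes k k1 k2 :: "real \<Rightarrow> real" and q :: real
  assumes DERIV_k: "\<And>t. (k has_field_derivative k1 t) (at t)"
    and DERIV_k1: "\<And>t. (k1 has_field_derivative k2 t) (at t)"
    and isCont_k2: "\<And>t. isCont k2 t"
    and at_0: "k 0 = 1" "k1 0 = 0" "k2 0 = -1"
    and near_0: "((\<lambda>h. 2 * (1 + k2 h) / h\<^sup>2) \<longlongrightarrow> q) (at 0)"
    and nondeg: "\<And>t. 0 < t \<Longrightarrow> 0 < 1 - (k t)\<^sup>2 - (k1 t)\<^sup>2"
    and cov: "\<And>a b c d t. 0 \<le> a\<^sup>2 + b\<^sup>2 + c\<^sup>2 + d\<^sup>2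
      + 2 * (a * c * k t + a * d * k1 t - b * c * k1 t - b * d * k2 t)"
    and integrable_k: "integrable lborel (\<lambda>t. (k t)\<^sup>2)"
    and integrable_k2: "integrable lborel (\<lambda>t. (k2 t)\<^sup>2)"
    and lim_k: "(k \<longlongrightarrow> 0) at_top" and lim_k1: "(k1 \<longlongrightarrow> 0) at_top" and lim_k2: "(k2 \<longlongrightarrow> 0) at_top"
begin

section \<open>The pointwise lower bound for the integrand\<close>

definition "D t = 1 - (k t)\<^sup>2 - (k1 t)\<^sup>2"
definition "a t = (k t * (k1 t)\<^sup>2 - (k t)\<^sup>2 * k2 t + k2 t) / D t"
definition "S t = D t / (1 - (k t)\<^sup>2) powr (3 / 2) * arcsin_primitive (a t) - 1"

text \<open>As a function of x = k the quotient y = arcsin x / sqrt (1 - x^2) satisfies (1 - x^2) y'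
  = 1 + x y, so the derivative of \<open>P\<close> can be written through \<open>A\<close>
  itself.\<close>

definition "A t = arcsin (k t) / sqrt (1 - (k t)\<^sup>2)"
definition "P t = k1 t * A t"
definition "P' t = k2 t * A t + (k1 t)\<^sup>2 * (1 + k t * A t) / (1 - (k t)\<^sup>2)"

lemma D_pos: "0 < t \<Longrightarrow> 0 < D t" using nondeg[of t] by (simp add: D_def)

lemma D_le: "D t \<le> 1 - (k t)\<^sup>2" by (simp add: D_def)

lemma u_pos: "0 < t \<Longrightarrow> 0 < 1 - (k t)\<^sup>2"
  using D_pos D_le order.strict_trans2 by blast

lemma abs_k_less: "0 < t \<Longrightarrow> \<bar>k t\<bar> < 1"
  using u_pos[of t] by (simp add: abs_square_less_1)

lemma isCont_k: "isCont k t" using DERIV_k by (rule DERIV_isCont)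
lemma isCont_k1: "isCont k1 t" using DERIV_k1 by (rule DERIV_isCont)

lemma continuous_on_k: "continuous_on X k" "continuous_on X k1" "continuous_on X k2"
  by (auto intro: continuous_at_imp_continuous_on isCont_k isCont_k1 isCont_k2)

lemma measurable_k[measurable]:
  "k \<in> borel_measurable borel" "k1 \<in> borel_measurable borel" "k2 \<in> borel_measurable borel"
  by (auto intro!: borel_measurable_continuous_onI continuous_on_k)

lemma abs_k2_le: "\<bar>k2 t\<bar> \<le> 1"
  using cov[of 0 1 0 1 t] cov[of 0 1 0 "-1" t] by auto

text \<open>With N the numerator of \<open>a\<close> and x, y, z the values of \<open>k\<close>,
  \<open>k1\<close>, \<open>k2\<close>, there are factorizations D - N = (1 + x) ((1 - z) (1 - x) -
  y^2) and D + N = (1 - x) ((1 + z) (1 + x) - y^2). The covariance form makes each second factor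
  nonnegative.\<close>

lemma a_bounds:
  assumes "0 < t" shows "a t \<in> {-1..1}"
proof -
  define x y z where "x = k t" and "y = k1 t" and "z = k2 t"
  have x: "-1 < x" "x < 1" using abs_k_less[OF assms] by (auto simp: x_def)
  have eq: "2 + 2 * v + 2 * (y / s)\<^sup>2 * s - 4 * (y / s) * y = 2 * ((1 + v) * s - y\<^sup>2) / s"
    if "s \<noteq> 0" for s v
    using that by (simp add: field_simps power2_eq_square)
  have 1: "y\<^sup>2 \<le> (1 - z) * (1 - x)"
  proof -
    have "0 \<le> 2 - 2 * z + 2 * w\<^sup>2 * (1 - x) - 4 * w * y" for w
      using cov[of "- w" 1 w 1 t]
      by (simp add: x_def y_def z_def algebra_simps power2_eq_square)
    \<comment> \<open>This \<open>w\<close> minimizes the quadratic polynomial just found; y / (1 +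
      x) below does the same for the other sign.\<close>
    from this[of "y / (1 - x)"]
    have "0 \<le> 2 - 2 * z + 2 * (y / (1 - x))\<^sup>2 * (1 - x) - 4 * (y / (1 - x)) * y" .
    also have "\<dots> = 2 * ((1 - z) * (1 - x) - y\<^sup>2) / (1 - x)"
      using x eq[of "1 - x" "- z"] by simp
    finally show ?thesis using x by (simp add: zero_le_divide_iff)
  qed
  have 2: "y\<^sup>2 \<le> (1 + z) * (1 + x)"
  proof -
    have "0 \<le> 2 + 2 * z + 2 * w\<^sup>2 * (1 + x) - 4 * w * y" for w
      using cov[of w 1 w "-1" t]
      by (simp add: x_def y_def z_def algebra_simps power2_eq_square)
    from this[of "y / (1 + x)"]
    have "0 \<le> 2 + 2 * z + 2 * (y / (1 + x))\<^sup>2 * (1 + x) - 4 * (y / (1 + x)) * y" .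
    also have "\<dots> = 2 * ((1 + z) * (1 + x) - y\<^sup>2) / (1 + x)"
      using x by (intro eq) simp
    finally show ?thesis using x by (simp add: zero_le_divide_iff)
  qed
  have "(1 + x) * y\<^sup>2 \<le> (1 + x) * ((1 - z) * (1 - x))" using 1 x by (intro mult_left_mono) auto
  then have u: "x * y\<^sup>2 - x\<^sup>2 * z + z \<le> D t"
    by (simp add: D_def x_def[symmetric] y_def[symmetric] algebra_simps power2_eq_square)
  have "(1 - x) * y\<^sup>2 \<le> (1 - x) * ((1 + z) * (1 + x))" using 2 x by (intro mult_left_mono) auto
  then have l: "- D t \<le> x * y\<^sup>2 - x\<^sup>2 * z + z"
    by (simp add: D_def x_def[symmetric] y_def[symmetric] algebra_simps power2_eq_square)
  have "a t = (x * y\<^sup>2 - x\<^sup>2 * z + z) / D t" by (simp add: a_def x_def y_def z_def)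
  then show ?thesis using u l D_pos[OF assms] by (auto simp: pos_divide_le_eq pos_le_divide_eq)
qed

text \<open>The origin of the tangent point: \<open>a t\<close> equals \<open>- k t\<close> exactly
  when \<open>k t + k2 t\<close> is 0, and the deviation is proportional to that sum.\<close>

lemma a_plus_k:
  assumes "0 < t" shows "a t + k t = (1 - (k t)\<^sup>2) * (k t + k2 t) / D t"
proof -
  have "a t + k t = (k t * (k1 t)\<^sup>2 - (k t)\<^sup>2 * k2 t + k2 t + k t * D t) / D t"
    using D_pos[OF assms] by (simp add: a_def add_divide_distrib)
  also have "k t * (k1 t)\<^sup>2 - (k t)\<^sup>2 * k2 t + k2 t + k t * D t = (1 - (k t)\<^sup>2) * (k t + k2 t)"
    by (simp add: D_def algebra_simps power2_eq_square)
  finally show ?thesis .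
qed

text \<open>The tangent line of \<open>arcsin_primitive\<close> at \<open>- k t\<close> turns the integrand into an exact
  derivative.\<close>

lemma S_lower:
  assumes t: "0 < t" shows "- P' t + (k t + k2 t)\<^sup>2 / 2 \<le> S t"
proof -
  define x u r w al where "x = k t" and "u = 1 - x\<^sup>2" and "r = sqrt u" and "w = x + k2 t" and "al = arcsin x"
  have u: "0 < u" "u \<le> 1" using u_pos[OF t] by (auto simp: u_def x_def)
  have r: "0 < r" "r * r = u" using u by (auto simp: r_def)
  have ur: "u \<le> r" using u by (simp add: r_def sqrt_ge_absD real_le_rsqrt power2_eq_square mult_left_le)
  have Dp: "0 < D t" "D t \<le> r" using D_pos[OF t] D_le[of t] ur by (auto simp: u_def x_def)
  have x: "x \<in> {-1..1}" using abs_k_less[OF t] by (auto simp: x_def)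
  have ak: "a t - (- x) = u * w / D t"
    using a_plus_k[OF t] by (simp add: u_def w_def x_def)
  have A: "A t = al / r" by (simp add: A_def al_def r_def u_def x_def)
  have m: "r + x * al - u * w / D t * al + (u * w / D t)\<^sup>2 / 2 \<le> arcsin_primitive (a t)"
    using arcsin_primitive_lower[OF a_bounds[OF t], of "-x"] x
    unfolding ak by (simp add: arcsin_primitive_def arcsin_minus al_def r_def u_def)
  \<comment> \<open>The quadratic remainder actually carries the factor \<open>r / D t\<close>,
    which is at least 1 because D is at most u and u is at most its square root.\<close>
  have "1 - P' t + w\<^sup>2 / 2 \<le> 1 - P' t + r / D t * (w\<^sup>2 / 2)"
    using mult_right_mono[of 1 "r / D t" "w\<^sup>2 / 2"] Dp by simp
  also have "\<dots> = D t / (u * r) * (r + x * al - u * w / D t * al + (u * w / D t)\<^sup>2 / 2)"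
  proof -
    have k1: "(k1 t)\<^sup>2 = u - D t" by (simp add: D_def u_def x_def)
    have k2: "k2 t = w - x" by (simp add: w_def)
    have P': "P' t = (w - x) * (al / r) + (u - D t) * (1 + x * (al / r)) / u"
      by (simp add: P'_def k1 k2 A u_def x_def)
    have "D t / (u * r) * (u * w / D t)\<^sup>2 = (u / r) * (w\<^sup>2 / D t)"
      using Dp u r(1) by (simp add: field_simps power2_eq_square)
    also have "u / r = r" using r by (simp add: field_simps)
    finally have sq: "D t / (u * r) * ((u * w / D t)\<^sup>2 / 2) = r / D t * (w\<^sup>2 / 2)" by simp
    have lin: "D t / (u * r) * (r + x * al - u * w / D t * al) = 1 - P' t"
      unfolding P' using Dp u r(1) by (simp add: field_simps)
    show ?thesis
      unfolding distrib_left[of _ _ "(u * w / D t)\<^sup>2 / 2"] lin sq ..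
  qed
  also have "\<dots> \<le> D t / (u * r) * arcsin_primitive (a t)"
    using m Dp u r by (intro mult_left_mono) auto
  also have "\<dots> = S t + 1"
    using u by (simp add: S_def powr_3_2 u_def r_def x_def)
  finally show ?thesis by (simp add: w_def x_def)
qed

lemma DERIV_P:
  assumes t: "0 < t" shows "(P has_field_derivative P' t) (at t)"
proof -
  define u r where "u = 1 - (k t)\<^sup>2" and "r = sqrt u"
  have u: "0 < u" using u_pos[OF t] by (simp add: u_def)
  have r: "0 < r" "r * r = u" using u by (auto simp: r_def)
  have ks: "-1 < k t" "k t < 1" using abs_k_less[OF t] by auto
  have as: "((\<lambda>t. arcsin (k t)) has_field_derivative inverse r * k1 t) (at t)"
    using DERIV_chain2[OF DERIV_arcsin[OF ks] DERIV_k] by (simp add: r_def u_def)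
  have us: "((\<lambda>t. 1 - (k t)\<^sup>2) has_field_derivative - 2 * k t * k1 t) (at t)"
    using DERIV_k by (auto intro!: derivative_eq_intros)
  have rs: "((\<lambda>t. sqrt (1 - (k t)\<^sup>2)) has_field_derivative inverse r / 2 * (- 2 * k t * k1 t)) (at t)"
    using DERIV_chain2[OF DERIV_real_sqrt us] u by (simp add: r_def u_def)
  have "(A has_field_derivative
      (inverse r * k1 t * r - arcsin (k t) * (inverse r / 2 * (- 2 * k t * k1 t))) / (r * r)) (at t)"
    unfolding A_def[abs_def]
    using DERIV_divide[OF as rs] r by (simp add: r_def u_def)
  also have "(inverse r * k1 t * r - arcsin (k t) * (inverse r / 2 * (- 2 * k t * k1 t))) / (r * r)
      = k1 t * (1 + k t * A t) / u"
    using r(1) unfolding r(2) by (simp add: A_def r_def[symmetric] u_def[symmetric] field_simps)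
  finally have "(A has_field_derivative k1 t * (1 + k t * A t) / u) (at t)" .
  from DERIV_mult[OF DERIV_k1 this] show ?thesis
    unfolding P_def[abs_def] P'_def by (simp add: u_def power2_eq_square algebra_simps)
qed

text \<open>Positivity of \<open>D\<close> bounds \<open>k1\<close> by the square root in the
  denominator of \<open>A\<close>, leaving at most the absolute value of arcsin. The bound is the
  limit of \<open>P\<close> at 0, so nothing is lost there.\<close>

lemma P_lower:
  assumes t: "0 < t" shows "- pi / 2 \<le> P t"
proof -
  define r where "r = sqrt (1 - (k t)\<^sup>2)"
  have r: "0 < r" using u_pos[OF t] by (simp add: r_def)
  have "\<bar>k1 t\<bar> \<le> r"
    using D_pos[OF t] by (simp add: r_def D_def real_le_rsqrt)
  then have "\<bar>k1 t\<bar> / r \<le> 1" using r by simp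
  moreover have "\<bar>arcsin (k t)\<bar> \<le> pi / 2"
    using arcsin_bounded[of "k t"] abs_k_less[OF t] by linarith
  ultimately have "\<bar>k1 t\<bar> / r * \<bar>arcsin (k t)\<bar> \<le> 1 * (pi / 2)"
    by (rule mult_mono) auto
  moreover have "\<bar>P t\<bar> = \<bar>k1 t\<bar> / r * \<bar>arcsin (k t)\<bar>"
    using r by (simp add: P_def A_def r_def[symmetric] abs_mult)
  ultimately show ?thesis by linarith
qed

lemma lim_P: "(P \<longlongrightarrow> 0) at_top"
proof -
  have "((\<lambda>t. arcsin (k t)) \<longlongrightarrow> arcsin 0) at_top"
    by (rule isCont_tendsto_compose[OF isCont_arcsin lim_k]) auto
  then have "((\<lambda>t. k1 t * (arcsin (k t) / sqrt (1 - (k t)\<^sup>2))) \<longlongrightarrow> 0 * (arcsin 0 / sqrt (1 - 0\<^sup>2))) at_top"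
    by (intro tendsto_intros lim_k lim_k1) auto
  then show ?thesis by (simp add: P_def[abs_def] A_def)
qed

section \<open>Integrability of the integrand\<close>

lemma continuous_on_D: "continuous_on X D"
  unfolding D_def[abs_def] by (intro continuous_intros continuous_on_k)

lemma continuous_on_A: "continuous_on {0<..} A"
  unfolding A_def[abs_def] using abs_k_less u_pos
  by (intro continuous_intros continuous_on_k) (force simp: abs_less_iff)+

lemma continuous_on_P': "continuous_on {0<..} P'"
  unfolding P'_def[abs_def] using u_pos
  by (intro continuous_intros continuous_on_k continuous_on_A) force

lemma continuous_on_S: "continuous_on {0<..} S"
proof -
  have a: "continuous_on {0<..} a"
    unfolding a_def[abs_def] using D_pos
    by (intro continuous_intros continuous_on_k continuous_on_D) force
  have m: "continuous_on {0<..} (\<lambda>t. arcsin_primitive (a t))"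
    unfolding arcsin_primitive_def using a_bounds
    by (intro continuous_intros a) force+
  show ?thesis
    unfolding S_def[abs_def] using u_pos
    by (intro continuous_intros m continuous_on_k continuous_on_D) (force simp: powr_eq_0_iff)+
qed

text \<open>The derivative of \<open>D\<close> is -2 k1 (k + k2). Since k + k2 is O(t^2) by
  \<open>near_0\<close>, this makes D of order t^4, against a denominator bounded below by a
  multiple of t^3.\<close>

lemma S_bounded_near_0: "\<exists>d>0. \<exists>B. \<forall>t. 0 < t \<longrightarrow> t \<le> d \<longrightarrow> \<bar>S t\<bar> \<le> B"
proof -
  define C where "C = \<bar>q\<bar> + 1"
  have C: "0 < C" "q < C" by (auto simp: C_def)
  have "\<forall>\<^sub>F h in at 0. 2 * (1 + k2 h) / h\<^sup>2 < C"
    using near_0 C by (intro order_tendstoD)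
  then obtain e where e: "e > 0" "\<And>h. h \<noteq> 0 \<Longrightarrow> \<bar>h\<bar> < e \<Longrightarrow> 2 * (1 + k2 h) / h\<^sup>2 < C"
    by (auto simp: eventually_at dist_real_def)
  have k2u: "k2 h \<le> -1 + C * h\<^sup>2" if "0 \<le> h" "h < e" for h
  proof (cases "h = 0")
    case True then show ?thesis by (simp add: at_0)
  next
    case False
    then have "0 < h\<^sup>2" by simp
    then have "2 * (1 + k2 h) < C * h\<^sup>2" using e(2)[of h] False that by (simp add: pos_divide_less_eq)
    moreover have "0 \<le> C * h\<^sup>2" using C by simp
    ultimately show ?thesis by simp
  qed
  \<comment> \<open>The entries keep \<open>d\<close> inside the range of \<open>near_0\<close>,
    give t^2 at most 1, and give C d^2 at most 1/2, which pushes \<open>k2\<close> below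
    -1/2.\<close>
  define d where "d = min (e / 2) (min 1 (1 / (2 * C)))"
  have d: "0 < d" "d < e" "d \<le> 1" "d \<le> 1 / (2 * C)" using e(1) C by (auto simp: d_def)
  have dC: "C * d\<^sup>2 \<le> 1 / 2"
  proof -
    have "C * d\<^sup>2 \<le> C * (d * 1)" using d C by (simp add: power2_eq_square)
    also have "\<dots> \<le> C * (1 / (2 * C))" using d C by (intro mult_left_mono) auto
    finally show ?thesis using C by simp
  qed
  have k2h: "k2 h \<le> - 1 / 2" if "0 \<le> h" "h \<le> d" for h
  proof -
    have "C * h\<^sup>2 \<le> C * d\<^sup>2" using that C by (intro mult_left_mono power_mono) auto
    then show ?thesis using k2u[of h] dC that d by simp
  qed
  \<comment> \<open>From here the bounds -1 and -1/2 on \<open>k2\<close> are integrated twice,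
    which encloses \<open>k1\<close> between -h and -h/2 and \<open>k\<close> between 1 - h^2/2 and
    1 - h^2/4.\<close>
  have k1u: "k1 h \<le> - h / 2" if h: "0 \<le> h" "h \<le> d" for h
  proof -
    have "k1 h + h / 2 \<le> k1 0 + 0 / 2"
    proof (rule DERIV_nonpos_imp_nonincreasing[OF h(1)])
      fix x assume "0 \<le> x" "x \<le> h"
      then have "k2 x + 1 / 2 \<le> 0" using k2h[of x] h by simp
      moreover have "((\<lambda>x. k1 x + x / 2) has_field_derivative k2 x + 1 / 2) (at x)"
        by (auto intro!: derivative_eq_intros DERIV_k1)
      ultimately show "\<exists>y. ((\<lambda>x. k1 x + x / 2) has_field_derivative y) (at x) \<and> y \<le> 0" by blast
    qed
    then show ?thesis by (simp add: at_0)
  qed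
  have k1l: "- h \<le> k1 h" if h: "0 \<le> h" for h
  proof -
    have "k1 0 + 0 \<le> k1 h + h"
    proof (rule DERIV_nonneg_imp_nondecreasing[OF h])
      fix x
      have "0 \<le> k2 x + 1" using abs_k2_le[of x] by simp
      moreover have "((\<lambda>x. k1 x + x) has_field_derivative k2 x + 1) (at x)"
        by (auto intro!: derivative_eq_intros DERIV_k1)
      ultimately show "\<exists>y. ((\<lambda>x. k1 x + x) has_field_derivative y) (at x) \<and> 0 \<le> y" by blast
    qed
    then show ?thesis by (simp add: at_0)
  qed
  have ku: "k h \<le> 1 - h\<^sup>2 / 4" if h: "0 \<le> h" "h \<le> d" for h
  proof -
    have "k h + h\<^sup>2 / 4 \<le> k 0 + 0\<^sup>2 / 4"
    proof (rule DERIV_nonpos_imp_nonincreasing[OF h(1)])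
      fix x assume "0 \<le> x" "x \<le> h"
      then have "k1 x + x / 2 \<le> 0" using k1u[of x] h by simp
      moreover have "((\<lambda>x. k x + x\<^sup>2 / 4) has_field_derivative k1 x + x / 2) (at x)"
        by (auto intro!: derivative_eq_intros DERIV_k)
      ultimately show "\<exists>y. ((\<lambda>x. k x + x\<^sup>2 / 4) has_field_derivative y) (at x) \<and> y \<le> 0" by blast
    qed
    then show ?thesis by (simp add: at_0)
  qed
  have kl: "1 - h\<^sup>2 / 2 \<le> k h" if h: "0 \<le> h" for h
  proof -
    have "k 0 + 0\<^sup>2 / 2 \<le> k h + h\<^sup>2 / 2"
    proof (rule DERIV_nonneg_imp_nondecreasing[OF h])
      fix x assume "0 \<le> x" "x \<le> h"
      then have "0 \<le> k1 x + x" using k1l[of x] by simp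
      moreover have "((\<lambda>x. k x + x\<^sup>2 / 2) has_field_derivative k1 x + x) (at x)"
        by (auto intro!: derivative_eq_intros DERIV_k)
      ultimately show "\<exists>y. ((\<lambda>x. k x + x\<^sup>2 / 2) has_field_derivative y) (at x) \<and> 0 \<le> y" by blast
    qed
    then show ?thesis by (simp add: at_0)
  qed
  have Du: "D h \<le> C * h ^ 4 / 2" if h: "0 \<le> h" "h \<le> d" for h
  proof -
    have "D h - C * h ^ 4 / 2 \<le> D 0 - C * 0 ^ 4 / 2"
    proof (rule DERIV_nonpos_imp_nonincreasing[OF h(1)])
      fix x assume x: "0 \<le> x" "x \<le> h"
      have "k x \<le> 1" using ku[of x] x h zero_le_power2[of x] by linarith
      then have "k x + k2 x \<le> C * x\<^sup>2" using k2u[of x] x h d by simp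
      then have "(- 2 * k1 x) * (k x + k2 x) \<le> (- 2 * k1 x) * (C * x\<^sup>2)"
        using k1u[of x] x h by (intro mult_left_mono) auto
      also have "\<dots> \<le> (2 * x) * (C * x\<^sup>2)"
        using k1l[of x] x C by (intro mult_right_mono) auto
      finally have "- 2 * k1 x * (k x + k2 x) - 2 * C * x ^ 3 \<le> 0"
        by (simp add: power2_eq_square power3_eq_cube algebra_simps)
      moreover have "((\<lambda>x. D x - C * x ^ 4 / 2) has_field_derivative
          (- 2 * k1 x * (k x + k2 x) - 2 * C * x ^ 3)) (at x)"
        unfolding D_def
        by (auto intro!: derivative_eq_intros DERIV_k DERIV_k1 simp: algebra_simps)
      ultimately show "\<exists>y. ((\<lambda>x. D x - C * x ^ 4 / 2) has_field_derivative y) (at x) \<and> y \<le> 0" by blast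
    qed
    then show ?thesis by (simp add: D_def at_0)
  qed
  \<comment> \<open>The quotient is at most (C t^4 / 2) / (t^3 / 8) = 4 C t, and
    \<open>arcsin_primitive\<close> is at most 3.\<close>
  have "\<bar>S t\<bar> \<le> 12 * C + 1" if t: "0 < t" "t \<le> d" for t
  proof -
    define u where "u = 1 - (k t)\<^sup>2"
    have "t\<^sup>2 \<le> 1" using t d by (simp add: power_le_one)
    then have k0: "0 \<le> k t" using kl[of t] t by simp
    have k1: "k t \<le> 1" using ku[of t] t zero_le_power2[of t] by linarith
    have "t\<^sup>2 / 4 * 1 \<le> (1 - k t) * (1 + k t)"
      using ku[of t] t k0 k1 by (intro mult_mono) auto
    then have u: "(t / 2)\<^sup>2 \<le> u"
      by (simp add: u_def power2_eq_square algebra_simps)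
    moreover have "0 < (t / 2)\<^sup>2" using t by simp
    ultimately have u0: "0 < u" by linarith
    have r: "t / 2 \<le> sqrt u" using real_le_rsqrt[OF u] .
    have ur: "t ^ 3 / 8 \<le> u * sqrt u"
      using mult_mono[OF u r] t u0 by (simp add: power2_eq_square power3_eq_cube)
    have "D t / (u * sqrt u) \<le> (C * t ^ 4 / 2) / (t ^ 3 / 8)"
      using Du[of t] ur t C by (intro frac_le) auto
    also have "\<dots> = 4 * C * t" using t by (simp add: field_simps eval_nat_numeral)
    also have "\<dots> \<le> 4 * C" using t d C by simp
    finally have "D t / (u * sqrt u) * arcsin_primitive (a t) \<le> (4 * C) * 3"
      using arcsin_primitive_le_3[OF a_bounds[OF t(1)]] arcsin_primitive_ge_1[OF a_bounds[OF t(1)]] C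
      by (intro mult_mono) auto
    moreover have "0 \<le> D t / (u * sqrt u) * arcsin_primitive (a t)"
      using D_pos[OF t(1)] u0 arcsin_primitive_ge_1[OF a_bounds[OF t(1)]]
      by (intro mult_nonneg_nonneg divide_nonneg_nonneg) auto
    moreover have "S t = D t / (u * sqrt u) * arcsin_primitive (a t) - 1"
      using u0 by (simp add: S_def u_def powr_3_2)
    ultimately show ?thesis by simp
  qed
  then show ?thesis using d(1) by blast
qed

text \<open>For small \<open>k\<close>, \<open>k1\<close>, \<open>k2\<close> each factor is 1 up to
  quadratic terms: \<open>a\<close> is linear in \<open>k1\<close> and \<open>k2\<close> up to
  higher order, and \<open>arcsin_primitive\<close> is quadratic around 0. The estimates give 32, so
  36 is generous.\<close>

lemma S_bound_at_top:
  "\<forall>\<^sub>F t in at_top. \<bar>S t\<bar> \<le> 36 * ((k t)\<^sup>2 + (k1 t)\<^sup>2 + (k2 t)\<^sup>2)"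
proof -
  \<comment> \<open>The threshold 1/8 yields |a| at most 2 (|k1| + |k2|), hence at most 1/2, the
    range of \<open>arcsin_primitive_upper\<close>.\<close>
  have "\<forall>\<^sub>F t in at_top. dist (k t) 0 < 1/8" "\<forall>\<^sub>F t in at_top. dist (k1 t) 0 < 1/8"
    "\<forall>\<^sub>F t in at_top. dist (k2 t) 0 < 1/8"
    by (rule tendstoD, (rule lim_k lim_k1 lim_k2), simp)+
  moreover have "\<forall>\<^sub>F t in at_top. (0::real) < t" by (rule eventually_gt_at_top)
  ultimately show ?thesis
  proof eventually_elim
    case (elim t)
    have sq: "(z::real)\<^sup>2 \<le> 1 / 64" if "\<bar>z\<bar> < 1 / 8" for z
      using power_mono[of "\<bar>z\<bar>" "1/8" 2] that by (simp add: power2_eq_square)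
    have s: "(k t)\<^sup>2 \<le> 1/64" "(k1 t)\<^sup>2 \<le> 1/64" "(k2 t)\<^sup>2 \<le> 1/64"
      by (rule sq, use elim in \<open>simp add: dist_real_def\<close>)+
    define u where "u = 1 - (k t)\<^sup>2"
    have u: "1 / 2 \<le> u" "u \<le> 1" using s zero_le_power2[of "k t"] unfolding u_def by linarith+
    have D: "1 / 2 \<le> D t" "D t \<le> u" using s D_le[of t] unfolding D_def u_def by linarith+
    have r: "u \<le> sqrt u" "sqrt u \<le> 1"
      using u by (auto simp: real_le_rsqrt power2_eq_square mult_left_le)
    have u0: "0 < u" "0 < sqrt u" using u by auto
    define n where "n = k t * (k1 t)\<^sup>2 - (k t)\<^sup>2 * k2 t + k2 t"
    have n: "\<bar>n\<bar> \<le> \<bar>k1 t\<bar> + \<bar>k2 t\<bar>"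
    proof -
      have "\<bar>k t * (k1 t)\<^sup>2\<bar> \<le> \<bar>k1 t\<bar>"
      proof -
        have "\<bar>k t * (k1 t)\<^sup>2\<bar> = (\<bar>k t\<bar> * \<bar>k1 t\<bar>) * \<bar>k1 t\<bar>"
          by (simp add: abs_mult power2_eq_square)
        also have "\<dots> \<le> 1 * \<bar>k1 t\<bar>"
          using elim by (intro mult_right_mono mult_le_one) (auto simp: dist_real_def)
        finally show ?thesis by simp
      qed
      moreover have "\<bar>u * k2 t\<bar> \<le> \<bar>k2 t\<bar>"
        using u mult_right_mono[of u 1 "\<bar>k2 t\<bar>"] by (simp add: abs_mult)
      moreover have "n = k t * (k1 t)\<^sup>2 + u * k2 t" by (simp add: n_def u_def algebra_simps)
      ultimately show ?thesis by linarith
    qed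
    have a: "\<bar>a t\<bar> \<le> 2 * \<bar>n\<bar>"
    proof -
      have "\<bar>a t\<bar> = \<bar>n\<bar> / D t" using D by (simp add: a_def n_def)
      also have "\<dots> \<le> \<bar>n\<bar> / (1 / 2)" using D by (intro divide_left_mono) auto
      finally show ?thesis by simp
    qed
    then have a2: "\<bar>a t\<bar> \<le> 1 / 2" using n elim by (simp add: dist_real_def)
    have "(a t)\<^sup>2 \<le> (2 * (\<bar>k1 t\<bar> + \<bar>k2 t\<bar>))\<^sup>2"
      using a n by (intro abs_le_square_iff[THEN iffD1]) simp
    also have "\<dots> \<le> 8 * ((k1 t)\<^sup>2 + (k2 t)\<^sup>2)"
      using sum_squares_bound[of "\<bar>k1 t\<bar>" "\<bar>k2 t\<bar>"] by (simp add: power2_sum power_mult_distrib)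
    finally have a3: "(a t)\<^sup>2 \<le> 8 * ((k1 t)\<^sup>2 + (k2 t)\<^sup>2)" .
    have S: "S t = D t / (u * sqrt u) * arcsin_primitive (a t) - 1"
      using u0 by (simp add: S_def u_def powr_3_2)
    have "D t * 1 \<le> D t / (u * sqrt u) * arcsin_primitive (a t)"
    proof (rule mult_mono)
      have "u * sqrt u \<le> 1" using u r u0 by (simp add: mult_le_one)
      then show "D t \<le> D t / (u * sqrt u)"
        using D u0 by (simp add: pos_le_divide_eq mult_left_le)
      show "1 \<le> arcsin_primitive (a t)"
        by (rule arcsin_primitive_ge_1[OF a_bounds[OF elim(4)]])
    qed (use D u0 in auto)
    then have lo: "- ((k t)\<^sup>2 + (k1 t)\<^sup>2) \<le> S t" unfolding S by (simp add: D_def)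
    have "D t / (u * sqrt u) \<le> u / (u * u)"
      using D u0 r by (intro frac_le mult_left_mono) auto
    then have "D t / (u * sqrt u) \<le> 1 / u" using u0 by simp
    then have "D t / (u * sqrt u) * arcsin_primitive (a t) \<le> 1 / u * (1 + 2 * (a t)\<^sup>2)"
      using arcsin_primitive_upper[OF a2] arcsin_primitive_ge_1[OF a_bounds[OF elim(4)]] u0
      by (intro mult_mono) auto
    also have "\<dots> = 1 + (k t)\<^sup>2 * (1 / u) + 2 * (a t)\<^sup>2 * (1 / u)"
      using u0 by (simp add: u_def field_simps)
    also have "\<dots> \<le> 1 + (k t)\<^sup>2 * 2 + 2 * (a t)\<^sup>2 * 2"
      using u by (intro add_mono mult_left_mono) (auto simp: field_simps)
    also have "\<dots> \<le> 1 + 2 * (k t)\<^sup>2 + 32 * ((k1 t)\<^sup>2 + (k2 t)\<^sup>2)"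
      using a3 by simp
    finally have "S t \<le> 2 * (k t)\<^sup>2 + 32 * ((k1 t)\<^sup>2 + (k2 t)\<^sup>2)" unfolding S by simp
    with lo show ?case
      using zero_le_power2[of "k t"] zero_le_power2[of "k1 t"] zero_le_power2[of "k2 t"]
      unfolding abs_le_iff distrib_left by linarith
  qed
qed


lemma S_set_integrable: "set_integrable lborel {0<..} S"
proof -
  \<comment> \<open>Integration by parts: the integral of k1^2 over [0, n] is the boundary term k k1
    at n minus the integral of k k2. The boundary term at 0 vanishes as \<open>k1 0 = 0\<close>, the
    one at n tends to 0, and monotone convergence concludes.\<close>
  have k1_int: "set_integrable lborel {0..} (\<lambda>t. (k1 t)\<^sup>2)"
  proof -
    have kk2: "integrable lborel (\<lambda>t. k t * k2 t)"
      by (rule sq_integrable_mult) (simp_all add: sq_integrable_def integrable_k integrable_k2)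
    define g where "g n t = indicator {0..real n} t *\<^sub>R (k1 t)\<^sup>2" for n t
    define h where "h n t = indicator {0..real n} t *\<^sub>R (k t * k2 t)" for n t
    have gi: "integrable lborel (g n)" for n
      unfolding g_def[abs_def] set_integrable_def[symmetric]
      by (intro borel_integrable_atLeastAtMost' continuous_intros continuous_on_k)
    have hi: "integrable lborel (h n)" for n
      unfolding h_def[abs_def] set_integrable_def[symmetric]
      by (intro borel_integrable_atLeastAtMost' continuous_intros continuous_on_k)
    have parts: "integral\<^sup>L lborel (g n) = k (real n) * k1 (real n) - integral\<^sup>L lborel (h n)" for n
    proof -
      have "integral\<^sup>L lborel (\<lambda>t. indicator {0..real n} t *\<^sub>R ((k1 t)\<^sup>2 + k t * k2 t))
          = k (real n) * k1 (real n) - k 0 * k1 0"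
      proof (rule integral_FTC_atLeastAtMost)
        fix x :: real
        have "((\<lambda>t. k t * k1 t) has_field_derivative (k1 x)\<^sup>2 + k x * k2 x) (at x)"
          using DERIV_mult[OF DERIV_k DERIV_k1] by (simp add: power2_eq_square algebra_simps)
        then show "((\<lambda>t. k t * k1 t) has_vector_derivative (k1 x)\<^sup>2 + k x * k2 x) (at x within {0..real n})"
          by (simp add: has_real_derivative_iff_has_vector_derivative has_vector_derivative_at_within)
      qed (auto intro!: continuous_intros continuous_on_k)
      moreover have "(\<lambda>t. indicator {0..real n} t *\<^sub>R ((k1 t)\<^sup>2 + k t * k2 t)) = (\<lambda>t. g n t + h n t)"
        by (simp add: g_def h_def fun_eq_iff algebra_simps)
      ultimately show ?thesis using gi hi by (simp add: at_0)
    qed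
    have "(\<lambda>n. integral\<^sup>L lborel (h n)) \<longlonglongrightarrow> integral\<^sup>L lborel (\<lambda>t. indicator {0..} t *\<^sub>R (k t * k2 t))"
    proof (rule integral_dominated_convergence[where w = "\<lambda>t. \<bar>k t * k2 t\<bar>"])
      show "AE t in lborel. (\<lambda>n. h n t) \<longlonglongrightarrow> indicator {0..} t *\<^sub>R (k t * k2 t)"
      proof (rule AE_I2)
        fix t :: real
        obtain N where N: "t \<le> real N" using real_arch_simple by blast
        show "(\<lambda>n. h n t) \<longlonglongrightarrow> indicator {0..} t *\<^sub>R (k t * k2 t)"
        proof (rule tendsto_eventually, rule eventually_sequentiallyI[of N])
          fix n assume "N \<le> n"
          then have "t \<le> real n" using N by linarith
          then show "h n t = indicator {0..} t *\<^sub>R (k t * k2 t)"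
            by (simp add: h_def indicator_def)
        qed
      qed
    qed (use kk2 hi in \<open>auto simp: h_def indicator_def\<close>)
    moreover have "(\<lambda>n. k (real n) * k1 (real n)) \<longlonglongrightarrow> 0 * 0"
      by (intro tendsto_mult filterlim_compose[OF lim_k] filterlim_compose[OF lim_k1] filterlim_real_sequentially)
    ultimately have lim: "(\<lambda>n. integral\<^sup>L lborel (g n))
        \<longlonglongrightarrow> 0 * 0 - integral\<^sup>L lborel (\<lambda>t. indicator {0..} t *\<^sub>R (k t * k2 t))"
      unfolding parts by (intro tendsto_diff)
    have "integrable lborel (\<lambda>t. indicator {0..} t *\<^sub>R (k1 t)\<^sup>2)"
    proof (rule integrable_monotone_convergence[OF gi _ _ lim])
      show "AE t in lborel. mono (\<lambda>n. g n t)"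
        by (auto simp: g_def mono_def indicator_def)
      show "AE t in lborel. (\<lambda>n. g n t) \<longlonglongrightarrow> indicator {0..} t *\<^sub>R (k1 t)\<^sup>2"
      proof (rule AE_I2)
        fix t :: real
        obtain N where N: "t \<le> real N" using real_arch_simple by blast
        show "(\<lambda>n. g n t) \<longlonglongrightarrow> indicator {0..} t *\<^sub>R (k1 t)\<^sup>2"
        proof (rule tendsto_eventually, rule eventually_sequentiallyI[of N])
          fix n assume "N \<le> n"
          then have "t \<le> real n" using N by linarith
          then show "g n t = indicator {0..} t *\<^sub>R (k1 t)\<^sup>2"
            by (simp add: g_def indicator_def)
        qed
      qed
    qed auto
    then show ?thesis by (simp add: set_integrable_def)
  qed
  obtain d B where d: "0 < d" and B: "\<And>t. 0 < t \<Longrightarrow> t \<le> d \<Longrightarrow> \<bar>S t\<bar> \<le> B"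
    using S_bounded_near_0 by blast
  obtain T where T: "\<And>t. T \<le> t \<Longrightarrow> \<bar>S t\<bar> \<le> 36 * ((k t)\<^sup>2 + (k1 t)\<^sup>2 + (k2 t)\<^sup>2)"
    using S_bound_at_top unfolding eventually_at_top_linorder by blast
  have "compact (S ` {d..T})"
    using d by (intro compact_continuous_image continuous_on_subset[OF continuous_on_S]) auto
  then obtain B' where "\<forall>x\<in>S ` {d..T}. norm x \<le> B'"
    using compact_imp_bounded bounded_iff by blast
  then have B': "\<And>t. d \<le> t \<Longrightarrow> t \<le> T \<Longrightarrow> \<bar>S t\<bar> \<le> B'" by auto
  \<comment> \<open>The constant covers both the bounded piece near 0 and the compact piece.
    Absolute values are taken since \<open>B'\<close> is unconstrained when \<open>T\<close> lies
    below \<open>d\<close>.\<close>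
  define w where "w t = indicator {0..max d T} t *\<^sub>R (\<bar>B\<bar> + \<bar>B'\<bar>)
    + 36 * ((k t)\<^sup>2 + indicator {0..} t *\<^sub>R (k1 t)\<^sup>2 + (k2 t)\<^sup>2)" for t
  have "integrable lborel w"
    unfolding w_def[abs_def]
    using integrable_k integrable_k2 k1_int
      borel_integrable_atLeastAtMost'[OF continuous_on_const, of 0 "max d T" "\<bar>B\<bar> + \<bar>B'\<bar>"]
    unfolding set_integrable_def
    by (intro Bochner_Integration.integrable_add integrable_mult_right)
  then show ?thesis
    unfolding set_integrable_def
  proof (rule Bochner_Integration.integrable_bound)
    show "(\<lambda>t. indicator {0<..} t *\<^sub>R S t) \<in> borel_measurable lborel"
      using borel_measurable_continuous_on_indicator[OF _ continuous_on_S] by simp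
    have "\<bar>S t\<bar> \<le> w t" if t: "0 < t" for t
    proof (cases "t \<le> max d T")
      case True
      then have "\<bar>S t\<bar> \<le> \<bar>B\<bar> + \<bar>B'\<bar>"
        using B[OF t] B'[of t] by (cases "t \<le> d") (auto simp: max_def split: if_splits)
      also have "\<dots> \<le> w t" using True t by (simp add: w_def)
      finally show ?thesis .
    next
      case False
      then show ?thesis using T[of t] t by (simp add: w_def)
    qed
    moreover have "0 \<le> w t" for t by (simp add: w_def)
    ultimately show "AE t in lborel. norm (indicator {0<..} t *\<^sub>R S t) \<le> norm (w t)"
      by (auto simp: indicator_def)
  qed
qed

section \<open>Integration over the half-line and strict positivity\<close>

lemma square_set_integrable: "set_integrable lborel {0<..} (\<lambda>t. (k t + k2 t)\<^sup>2)"
proof -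
  have "sq_integrable lborel (\<lambda>t. 1 * k t + 1 * k2 t)"
    by (rule sq_integrable_lincomb) (simp_all add: sq_integrable_def integrable_k integrable_k2)
  then show ?thesis
    unfolding set_integrable_def sq_integrable_def by (intro integrable_mult_indicator) auto
qed

text \<open>Integrating \<open>S_lower\<close> leaves the difference of the end values of
  \<open>P\<close>. The right one tends to 0, while \<open>P_lower\<close> bounds the left one for
  every \<open>n\<close>, so only a one-sided estimate enters at the origin.\<close>

lemma S_integral_lower:
  "- pi / 2 + (LBINT t:{0<..}. (k t + k2 t)\<^sup>2) / 2 \<le> (LBINT t:{0<..}. S t)"
proof (rule LIMSEQ_le)
  let ?J = "\<lambda>n. {1 / real (Suc n)..real (Suc n)}"
  have pos: "t \<in> ?J n \<Longrightarrow> 0 < t" for t n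
    by (auto intro: order.strict_trans2[rotated])
  then have sub: "?J n \<subseteq> {0<..}" for n by auto
  show "(\<lambda>n. LBINT t:?J n. S t) \<longlonglongrightarrow> (LBINT t:{0<..}. S t)"
    by (rule set_integral_exhaust[OF S_set_integrable])
  have "(\<lambda>n. P (real (Suc n))) \<longlonglongrightarrow> 0"
    by (rule filterlim_compose[OF lim_P]) (simp add: filterlim_sequentially_Suc filterlim_real_sequentially del: of_nat_Suc)
  then have "(\<lambda>n. - pi / 2 - P (real (Suc n)) + (LBINT t:?J n. (k t + k2 t)\<^sup>2) / 2)
    \<longlonglongrightarrow> - pi / 2 - 0 + (LBINT t:{0<..}. (k t + k2 t)\<^sup>2) / 2"
    by (intro tendsto_intros set_integral_exhaust[OF square_set_integrable]) auto
  then show "(\<lambda>n. - pi / 2 - P (real (Suc n)) + (LBINT t:?J n. (k t + k2 t)\<^sup>2) / 2)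
    \<longlonglongrightarrow> - pi / 2 + (LBINT t:{0<..}. (k t + k2 t)\<^sup>2) / 2" by simp
  have "- pi / 2 - P (real (Suc n)) + (LBINT t:?J n. (k t + k2 t)\<^sup>2) / 2 \<le> (LBINT t:?J n. S t)" for n
  proof -
    have le: "1 / real (Suc n) \<le> real (Suc n)" by (simp add: field_simps)
    have cP: "continuous_on (?J n) P'" using continuous_on_P' sub by (rule continuous_on_subset)
    have FTC: "(LBINT t:?J n. P' t) = P (real (Suc n)) - P (1 / real (Suc n))"
      unfolding set_lebesgue_integral_def
    proof (rule integral_FTC_atLeastAtMost[OF le _ cP])
      fix x assume "1 / real (Suc n) \<le> x" "x \<le> real (Suc n)"
      then have "0 < x" using pos[of x n] by simp
      then show "(P has_vector_derivative P' x) (at x within ?J n)"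
        using DERIV_P by (simp add: has_real_derivative_iff_has_vector_derivative has_vector_derivative_at_within)
    qed
    have iP: "set_integrable lborel (?J n) P'" by (rule borel_integrable_atLeastAtMost'[OF cP])
    have isq: "set_integrable lborel (?J n) (\<lambda>t. (k t + k2 t)\<^sup>2 / 2)"
      by (intro borel_integrable_atLeastAtMost' continuous_intros continuous_on_k) auto
    have "(LBINT t:?J n. (k t + k2 t)\<^sup>2 / 2 - P' t) \<le> (LBINT t:?J n. S t)"
    proof (rule set_integral_mono)
      show "set_integrable lborel (?J n) (\<lambda>t. (k t + k2 t)\<^sup>2 / 2 - P' t)"
        by (rule set_integral_diff(1)[OF isq iP])
      show "set_integrable lborel (?J n) S"
        by (rule set_integrable_subset[OF S_set_integrable _ sub]) auto
      fix t assume "t \<in> ?J n"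
      from S_lower[OF pos[OF this]] show "(k t + k2 t)\<^sup>2 / 2 - P' t \<le> S t" by simp
    qed
    moreover have "(LBINT t:?J n. (k t + k2 t)\<^sup>2 / 2 - P' t)
        = (LBINT t:?J n. (k t + k2 t)\<^sup>2) / 2 - (P (real (Suc n)) - P (1 / real (Suc n)))"
      unfolding set_integral_diff(2)[OF isq iP] FTC by simp
    moreover have "- pi / 2 \<le> P (1 / real (Suc n))" by (rule P_lower) simp
    ultimately show ?thesis by linarith
  qed
  then show "\<exists>N. \<forall>n\<ge>N. - pi / 2 - P (real (Suc n)) + (LBINT t:?J n. (k t + k2 t)\<^sup>2) / 2
      \<le> (LBINT t:?J n. S t)" by blast
qed

lemma square_integral_pos: "0 < (LBINT t:{0<..}. (k t + k2 t)\<^sup>2)"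
proof (rule ccontr)
  let ?g = "\<lambda>t. indicator {0<..} t *\<^sub>R (k t + k2 t)\<^sup>2"
  assume "\<not> ?thesis"
  moreover have nn: "AE t in lborel. 0 \<le> ?g t" by simp
  ultimately have "integral\<^sup>L lborel ?g = 0"
    using integral_nonneg_AE[OF nn] unfolding set_lebesgue_integral_def by linarith
  then have ae: "AE t in lborel. ?g t = 0"
    using integral_nonneg_eq_0_iff_AE[OF _ nn] square_set_integrable by (simp add: set_integrable_def)
  \<comment> \<open>An almost everywhere statement suffices, because \<open>D 1 - D 0\<close> is the
    integral of the derivative of \<open>D\<close>, which contains the factor
    \<open>k t + k2 t\<close>. Vanishing would force \<open>D 1 = D 0 = 0\<close>.\<close>
  have "integral\<^sup>L lborel (\<lambda>t. indicator {0..1} t *\<^sub>R (- 2 * k1 t * (k t + k2 t))) = D 1 - D 0"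
  proof (rule integral_FTC_atLeastAtMost)
    fix x :: real
    have "(D has_field_derivative (- 2 * k1 x * (k x + k2 x))) (at x)"
      unfolding D_def[abs_def] by (auto intro!: derivative_eq_intros DERIV_k DERIV_k1 simp: algebra_simps)
    then show "(D has_vector_derivative (- 2 * k1 x * (k x + k2 x))) (at x within {0..1})"
      by (simp add: has_real_derivative_iff_has_vector_derivative has_vector_derivative_at_within)
  qed (auto intro!: continuous_intros continuous_on_k)
  moreover have "integral\<^sup>L lborel (\<lambda>t. indicator {0..1} t *\<^sub>R (- 2 * k1 t * (k t + k2 t)))
      = integral\<^sup>L lborel (\<lambda>t::real. 0 :: real)"
  proof (rule integral_cong_AE)
    show "AE t in lborel. indicator {0..1} t *\<^sub>R (- 2 * k1 t * (k t + k2 t)) = 0"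
      using ae
    proof eventually_elim
      case (elim t)
      \<comment> \<open>The point 0 lies in the interval of integration but outside the open
        half-line; there the integrand vanishes through \<open>k1 0 = 0\<close>.\<close>
      then show ?case by (cases "t = 0") (auto simp: indicator_def at_0 split: if_splits)
    qed
  qed auto
  ultimately show False using D_pos[of 1] by (simp add: D_def at_0)
qed

end

text \<open>The first two conjuncts certify that the formula means what it says: a division by 0 or
  the integral of a nonintegrable function would silently be 0, and arcsin is meaningful only on
  [-1, 1].\<close>

theorem corollary4p8:
  fixes M :: "'a measure" and f :: "real \<Rightarrow> 'a \<Rightarrow> real" and \<kappa> :: "real \<Rightarrow> real"
  assumes "prob_space M"
    and "gaussian_process M f"
    and "centered_process M f"
    and "stationary_process M f"
    and "process_class_C 2 M f"
    and "normalized_process M f"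
    and kappa: "\<kappa> = correlation M f"
    and "integrable lborel (\<lambda>x. (\<kappa> x)\<^sup>2)"
    and "integrable lborel (\<lambda>x. ((deriv ^^ 2) \<kappa> x)\<^sup>2)"
    and "((\<lambda>\<eta>. tail_norm 2 \<eta> \<kappa>) \<longlongrightarrow> 0) at_top"
  shows "(\<forall>t>0. 1 - (\<kappa> t)\<^sup>2 - (deriv \<kappa> t)\<^sup>2 > 0 \<and> a_fun \<kappa> t \<in> {-1..1})
    \<and> set_integrable lborel {0<..} (sigma_integrand \<kappa>)
    \<and> sigma_squared \<kappa> \<ge> 1 / pi\<^sup>2 * (LBINT z:{0<..}. (\<kappa> z + (deriv ^^ 2) \<kappa> z)\<^sup>2)
    \<and> 1 / pi\<^sup>2 * (LBINT z:{0<..}. (\<kappa> z + (deriv ^^ 2) \<kappa> z)\<^sup>2) > 0"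
proof -
  interpret pr: smooth_stationary_gaussian M f
    using assms(1-6) by (simp add: smooth_stationary_gaussian_def smooth_stationary_gaussian_axioms_def)
  have d1: "deriv \<kappa> = pr.\<kappa>'" and d2: "(deriv ^^ 2) \<kappa> = pr.\<kappa>''"
    unfolding kappa by (rule pr.deriv_\<kappa> pr.deriv2_\<kappa>)+
  have lim: "(\<kappa> \<longlongrightarrow> 0) at_top" "(pr.\<kappa>' \<longlongrightarrow> 0) at_top" "(pr.\<kappa>'' \<longlongrightarrow> 0) at_top"
    using tail_norm_tendsto[OF assms(10), of 0] tail_norm_tendsto[OF assms(10), of 1]
      tail_norm_tendsto[OF assms(10), of 2] unfolding d2 by (simp_all add: d1)
  interpret co: nondegenerate_correlation \<kappa> pr.\<kappa>' pr.\<kappa>'' "integral\<^sup>L M (\<lambda>\<omega>. (pr.f''0 \<omega>)\<^sup>2)"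
  proof
    show "0 < 1 - (\<kappa> t)\<^sup>2 - (pr.\<kappa>' t)\<^sup>2" if "0 < t" for t
      using pr.nondegenerate[OF _ _ that] lim by (simp add: kappa)
  qed (use lim assms(8) assms(9)[unfolded d2] pr.DERIV_\<kappa> pr.DERIV_\<kappa>' pr.isCont_\<kappa>'' pr.\<kappa>_at_0 pr.\<kappa>''_near_0
      pr.covariance_nonneg in \<open>simp_all add: kappa\<close>)
  have a: "a_fun \<kappa> t = co.a t" for t
    by (simp add: a_fun_def co.a_def co.D_def d1 d2)
  have S: "sigma_integrand \<kappa> = co.S"
    by (simp add: fun_eq_iff sigma_integrand_def co.S_def co.D_def arcsin_primitive_def a d1)
  define I where "I = (LBINT z:{0<..}. (\<kappa> z + pr.\<kappa>'' z)\<^sup>2)"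
  \<comment> \<open>The factor turns -pi/2 into -1/pi, which cancels the first term of
    \<open>sigma_squared\<close>, and I/2 into I/pi^2.\<close>
  have "2 / pi\<^sup>2 * (- pi / 2 + I / 2) \<le> 2 / pi\<^sup>2 * (LBINT t:{0<..}. co.S t)"
    unfolding I_def by (intro mult_left_mono co.S_integral_lower) simp
  moreover have "2 / pi\<^sup>2 * (- pi / 2 + I / 2) = - 1 / pi + 1 / pi\<^sup>2 * I"
    by (simp add: field_simps power2_eq_square)
  ultimately have "1 / pi\<^sup>2 * I \<le> sigma_squared \<kappa>"
    unfolding sigma_squared_def S by simp
  moreover have "0 < 1 / pi\<^sup>2 * I"
    using co.square_integral_pos by (simp add: I_def)
  ultimately show ?thesis
    unfolding S d2 d1 a I_def using co.nondeg co.a_bounds co.S_set_integrable by blast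
qed

end
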